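(* Let $(W,S)$ be a Coxeter system, let $I,J\subset S$ be finitary and let $p$ be a $(J,I)$-coset, with left redundancy $K=J\cap\underline pI\underline p^{-1}$ and right redundancy $L=I\cap\underline p^{-1}J\underline p$. Let $[[J,K]]$ denote any expression which removes one simple reflection at a time to get from $J$ to $K$, and let $[[L,I]]$ denote any expression which adds one simple reflection at a time to get from $L$ to $I$. If $M_\bullet$ is any reduced expression for the core $p^{\mathrm{core}}$, then $$[[J,K]]\circ M_\bullet\circ[[L,I]]$$ is a reduced expression for $p$.
   Context: Let $(W,S)$ be a Coxeter system with identity $e$ and Bruhat order $\le$. For $I\subset S$ let $W_I$ be the parabolic subgroup generated by $I$; $I$ is finitary if $W_I$ is finite. For finitary $I,J$, a $(J,I)$-coset is a double coset $p\in W_J\backslash W/W_I$ (the pair $(J,I)$ is part of the data); it has a unique Bruhat-maximal element $\overline{p}$ and a unique Bruhat-minimal element $\underline{p}$. The core of $p$, $p^{\mathrm{core}}$, is the $(K,L)$-coset with minimal element $\underline p$, where $K=J\cap\underline pI\underline p^{-1}$, $L=I\cap\underline p^{-1}J\underline p$. A (singular) expression is a sequence $[I_0,\dots,I_d]$ of finitary subsets of $S$, consecutive ones differing by adding or removing exactly one element of $S$. Its forward path is the sequence $p_0,\dots,p_d$ where $p_i$ is an $(I_0,I_i)$-coset, $e\in p_0$; if $I_i\subset I_{i+1}$, $p_{i+1}$ is the $(I_0,I_{i+1})$-coset containing $p_i$; if $I_i\supset I_{i+1}$, $p_{i+1}$ is the $(I_0,I_{i+1})$-coset containing $\overline{p_i}$.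 It is an expression for $p_d$. Put $K_i=I_0\cap\underline{p_i}I_i\underline{p_i}^{-1}$. The expression is reduced if for every $i$ with $I_i\subset I_{i+1}$ one has $\underline{p_i}=\underline{p_{i+1}}$ and $K_i=K_{i+1}$. $\circ$ denotes concatenation of expressions (identifying the last set of one with the first of the next). *)

theory Defs
  imports "HOL-Algebra.Algebra"
begin

section \<open>Coxeter systems\<close>

definition word_prod :: "('a, 'b) monoid_scheme \<Rightarrow> 'a list \<Rightarrow> 'a" where
  "word_prod G ws = foldr (\<otimes>\<^bsub>G\<^esub>) ws \<one>\<^bsub>G\<^esub>"

text \<open>
  The congruence on words over \<open>S\<close> generated by \<open>(s t)\<^sup>m = 1\<close> with \<open>m\<close> the order of
  \<open>s \<otimes> t\<close> in \<open>G\<close>. \<open>group.ord\<close> is \<open>0\<close> for elements of infinite order, so such pairs contribute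
  only the trivial relation. For involutions \<open>s = t\<close> it contributes \<open>s s = 1\<close>, so formal inverses
  are not needed: the quotient monoid is the group presented by these relations.
\<close>

inductive coxeter_word_eq :: "('a, 'b) monoid_scheme \<Rightarrow> 'a set \<Rightarrow> 'a list \<Rightarrow> 'a list \<Rightarrow> bool"
  for G (structure) and S where
  relator: "set u \<subseteq> S \<Longrightarrow> set v \<subseteq> S \<Longrightarrow> s \<in> S \<Longrightarrow> t \<in> S \<Longrightarrow>
    coxeter_word_eq G S (u @ concat (replicate (group.ord G (s \<otimes> t)) [s, t]) @ v) (u @ v)"
| refl: "set u \<subseteq> S \<Longrightarrow> coxeter_word_eq G S u u"
| sym: "coxeter_word_eq G S u v \<Longrightarrow> coxeter_word_eq G S v u"
| trans: "coxeter_word_eq G S u v \<Longrightarrow> coxeter_word_eq G S v w \<Longrightarrow> coxeter_word_eq G S u w"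

text \<open>
  The last axiom says that the relations \<open>(s t)\<^sup>m = 1\<close> present \<open>G\<close>: words with equal value in \<open>G\<close>
  are already equal modulo these relations. The set \<open>S\<close> may be infinite.
\<close>

locale coxeter_system = group G for G :: "('a, 'b) monoid_scheme" (structure) +
  fixes S :: "'a set"
  assumes S_subset: "S \<subseteq> carrier G"
    and S_generates: "generate G S = carrier G"
    and S_neq_one: "s \<in> S \<Longrightarrow> s \<noteq> \<one>"
    and S_involution: "s \<in> S \<Longrightarrow> s \<otimes> s = \<one>"
    and S_presents: "set u \<subseteq> S \<Longrightarrow> set v \<subseteq> S \<Longrightarrow> word_prod G u = word_prod G v
      \<Longrightarrow> coxeter_word_eq G S u v"

definition cox_length :: "('a, 'b) monoid_scheme \<Rightarrow> 'a set \<Rightarrow> 'a \<Rightarrow> nat" where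
  "cox_length G S w = (LEAST n. \<exists>ws. set ws \<subseteq> S \<and> length ws = n \<and> word_prod G ws = w)"

definition reflections :: "('a, 'b) monoid_scheme \<Rightarrow> 'a set \<Rightarrow> 'a set" where
  "reflections G S = {x \<otimes>\<^bsub>G\<^esub> s \<otimes>\<^bsub>G\<^esub> inv\<^bsub>G\<^esub> x |x s. x \<in> carrier G \<and> s \<in> S}"

definition bruhat_le :: "('a, 'b) monoid_scheme \<Rightarrow> 'a set \<Rightarrow> 'a \<Rightarrow> 'a \<Rightarrow> bool" where
  "bruhat_le G S u v \<longleftrightarrow>
    (u, v) \<in> {(x, x \<otimes>\<^bsub>G\<^esub> t) |x t. x \<in> carrier G \<and> t \<in> reflections G S \<and>
      cox_length G S x < cox_length G S (x \<otimes>\<^bsub>G\<^esub> t)}\<^sup>*"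

section \<open>Double cosets\<close>

definition finitary :: "('a, 'b) monoid_scheme \<Rightarrow> 'a set \<Rightarrow> 'a set \<Rightarrow> bool" where
  "finitary G S I \<longleftrightarrow> I \<subseteq> S \<and> finite (generate G I)"

text \<open>
  The set of \<open>(J, I)\<close>-cosets. The pair \<open>(J, I)\<close> is part of the data of a coset; below it is always
  passed along explicitly with the underlying set \<open>p\<close>.
\<close>

definition double_cosets :: "('a, 'b) monoid_scheme \<Rightarrow> 'a set \<Rightarrow> 'a set \<Rightarrow> 'a set set" where
  "double_cosets G J I =
    {generate G J <#>\<^bsub>G\<^esub> {x} <#>\<^bsub>G\<^esub> generate G I |x. x \<in> carrier G}"

definition max_elt :: "('a, 'b) monoid_scheme \<Rightarrow> 'a set \<Rightarrow> 'a set \<Rightarrow> 'a" where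
  "max_elt G S p = (THE x. x \<in> p \<and> (\<forall>y\<in>p. bruhat_le G S x y \<longrightarrow> y = x))"

definition min_elt :: "('a, 'b) monoid_scheme \<Rightarrow> 'a set \<Rightarrow> 'a set \<Rightarrow> 'a" where
  "min_elt G S p = (THE x. x \<in> p \<and> (\<forall>y\<in>p. bruhat_le G S y x \<longrightarrow> y = x))"

definition left_redundancy ::
  "('a, 'b) monoid_scheme \<Rightarrow> 'a set \<Rightarrow> 'a set \<Rightarrow> 'a set \<Rightarrow> 'a set \<Rightarrow> 'a set" where
  "left_redundancy G S J I p =
    J \<inter> (min_elt G S p <#\<^bsub>G\<^esub> I #>\<^bsub>G\<^esub> inv\<^bsub>G\<^esub> (min_elt G S p))"

definition right_redundancy ::
  "('a, 'b) monoid_scheme \<Rightarrow> 'a set \<Rightarrow> 'a set \<Rightarrow> 'a set \<Rightarrow> 'a set \<Rightarrow> 'a set" where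
  "right_redundancy G S J I p =
    I \<inter> (inv\<^bsub>G\<^esub> (min_elt G S p) <#\<^bsub>G\<^esub> J #>\<^bsub>G\<^esub> min_elt G S p)"

definition core ::
  "('a, 'b) monoid_scheme \<Rightarrow> 'a set \<Rightarrow> 'a set \<Rightarrow> 'a set \<Rightarrow> 'a set \<Rightarrow> 'a set" where
  "core G S J I p =
    (THE q. q \<in> double_cosets G (left_redundancy G S J I p) (right_redundancy G S J I p) \<and>
      min_elt G S q = min_elt G S p)"

section \<open>Singular expressions\<close>

definition is_expression :: "('a, 'b) monoid_scheme \<Rightarrow> 'a set \<Rightarrow> 'a set list \<Rightarrow> bool" where
  "is_expression G S Is \<longleftrightarrow> Is \<noteq> [] \<and> (\<forall>I\<in>set Is. finitary G S I) \<and>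
    (\<forall>i. Suc i < length Is \<longrightarrow>
      (\<exists>s\<in>S. s \<notin> Is ! i \<and> Is ! Suc i = insert s (Is ! i) \<or>
             s \<in> Is ! i \<and> Is ! Suc i = Is ! i - {s}))"

text \<open>Only the values at indices \<open>i < length Is\<close> are meaningful.\<close>

primrec forward_path ::
  "('a, 'b) monoid_scheme \<Rightarrow> 'a set \<Rightarrow> 'a set list \<Rightarrow> nat \<Rightarrow> 'a set" where
  "forward_path G S Is 0 =
    (THE q. q \<in> double_cosets G (Is ! 0) (Is ! 0) \<and> \<one>\<^bsub>G\<^esub> \<in> q)"
| "forward_path G S Is (Suc i) =
    (if Is ! i \<subset> Is ! Suc i
     then (THE q. q \<in> double_cosets G (Is ! 0) (Is ! Suc i) \<and> forward_path G S Is i \<subseteq> q)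
     else (THE q. q \<in> double_cosets G (Is ! 0) (Is ! Suc i) \<and>
       max_elt G S (forward_path G S Is i) \<in> q))"

text \<open>\<open>Is\<close> is an expression for the \<open>(J, I)\<close>-coset \<open>p\<close>.\<close>

definition expression_for ::
  "('a, 'b) monoid_scheme \<Rightarrow> 'a set \<Rightarrow> 'a set \<Rightarrow> 'a set \<Rightarrow> 'a set \<Rightarrow> 'a set list \<Rightarrow> bool" where
  "expression_for G S J I p Is \<longleftrightarrow> is_expression G S Is \<and> hd Is = J \<and> last Is = I \<and>
    forward_path G S Is (length Is - 1) = p"

definition reduced :: "('a, 'b) monoid_scheme \<Rightarrow> 'a set \<Rightarrow> 'a set list \<Rightarrow> bool" where
  "reduced G S Is \<longleftrightarrow>
    (\<forall>i. Suc i < length Is \<longrightarrow> Is ! i \<subset> Is ! Suc i \<longrightarrow>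
      min_elt G S (forward_path G S Is i) = min_elt G S (forward_path G S Is (Suc i)) \<and>
      left_redundancy G S (Is ! 0) (Is ! i) (forward_path G S Is i) =
      left_redundancy G S (Is ! 0) (Is ! Suc i) (forward_path G S Is (Suc i)))"

definition reduced_expression_for ::
  "('a, 'b) monoid_scheme \<Rightarrow> 'a set \<Rightarrow> 'a set \<Rightarrow> 'a set \<Rightarrow> 'a set \<Rightarrow> 'a set list \<Rightarrow> bool" where
  "reduced_expression_for G S J I p Is \<longleftrightarrow> expression_for G S J I p Is \<and> reduced G S Is"

text \<open>Meant for \<open>last Is = hd Js\<close>; this common set appears once in the result.\<close>

definition expr_concat :: "'a set list \<Rightarrow> 'a set list \<Rightarrow> 'a set list"  (infixl \<open>\<circ>\<^sub>e\<close> 65) where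
  "Is \<circ>\<^sub>e Js = Is @ tl Js"

definition removing_expression ::
  "('a, 'b) monoid_scheme \<Rightarrow> 'a set \<Rightarrow> 'a set \<Rightarrow> 'a set \<Rightarrow> 'a set list \<Rightarrow> bool" where
  "removing_expression G S J K Is \<longleftrightarrow> is_expression G S Is \<and> hd Is = J \<and> last Is = K \<and>
    (\<forall>i. Suc i < length Is \<longrightarrow> Is ! Suc i \<subset> Is ! i)"

definition adding_expression ::
  "('a, 'b) monoid_scheme \<Rightarrow> 'a set \<Rightarrow> 'a set \<Rightarrow> 'a set \<Rightarrow> 'a set list \<Rightarrow> bool" where
  "adding_expression G S L I Is \<longleftrightarrow> is_expression G S Is \<and> hd Is = L \<and> last Is = I \<and>
    (\<forall>i. Suc i < length Is \<longrightarrow> Is ! i \<subset> Is ! Suc i)"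

end

theory Submission
  imports Defs "HOL-Library.Sublist"
begin

text \<open>
  Write \<open>W\<^sub>J\<close> for \<open>generate G J\<close>, let \<open>d\<close> be the minimal element of \<open>p\<close>, let \<open>q\<^sub>i\<close> be the cosets on
  the forward path of \<open>M\<close> and \<open>d\<^sub>i\<close> their minimal elements, so that \<open>q\<^sub>i\<close> is the
  \<open>(K, M\<^sub>i)\<close>-coset of \<open>d\<^sub>i\<close> and the last \<open>d\<^sub>i\<close> is \<open>d\<close>.

  The core has the largest left redundancy that its left parabolic allows, namely \<open>K\<close> itself. Along
  a reduced expression redundancies never grow: they are constant on ascending steps by
  definition, and a descending step can only shrink them. As the last one is all of \<open>K\<close>, every
  coset \<open>q\<^sub>i\<close> has left redundancy \<open>K\<close> and is therefore the single coset \<open>d\<^sub>i W\<close> with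
  \<open>W = generate G M\<^sub>i\<close>. Reading the expression backwards from \<open>d\<close> shows more: no
  \<open>d\<^sub>i\<close> has a left descent in the larger set \<open>J\<close>, and the redundancy computed with \<open>J\<close> instead
  of \<open>K\<close> is still \<open>K\<close> (\<open>redundancy_down_step\<close>, \<open>reduced_path_invariant\<close>).

  The initial segment from \<open>J\<close> to \<open>K\<close> only removes reflections, so it imposes no condition, and its
  cosets are all the set \<open>W\<^sub>J\<close>. Starting \<open>M\<close> from \<open>W\<^sub>J\<close> replaces \<open>q\<^sub>i\<close> by \<open>W\<^sub>J q\<^sub>i\<close>
  (\<open>forward_path_suffix\<close>), and by the previous paragraph this changes neither the minimal elements nor
  the redundancies; hence the ascending steps of \<open>M\<close> still satisfy the condition. At a descending step
  one needs that the maxima of \<open>q\<^sub>i\<close> and of \<open>W\<^sub>J q\<^sub>i\<close> lie in the same coset of \<open>W\<^sub>J\<close>. This is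
  \<open>descends_right_same_coset\<close>: an element of \<open>W\<^sub>J d\<^sub>i W\<close> with all right descents in \<open>M\<^sub>i\<close> has
  the form \<open>a d\<^sub>i w\<close> with \<open>w\<close> the longest element of \<open>W\<close>. On the final segment
  from \<open>L\<close> to \<open>I\<close> the minimal element stays \<open>d\<close>, and the redundancy is squeezed between its values at
  \<open>L\<close> and at \<open>I\<close>, which are both \<open>K\<close>.

  The Coxeter group theory behind this rests on one fact, \<open>reduced_factorisation\<close>: in a product
  \<open>a d b\<close> one may delete letters until the lengths of the three factors add up. It comes from the
  deletion property, which is obtained from the presentation by counting, modulo 2, how often each
  reflection occurs along a word. Factorisations with additive lengths identify the Bruhat-minimal
  and Bruhat-maximal elements of a double coset as the elements without, respectively with all,
  descents in \<open>J\<close> on the left and in \<open>I\<close> on the right.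
\<close>

section \<open>Concatenation of expressions\<close>

lemma expr_concat_length:
  "Is \<noteq> [] \<Longrightarrow> Js \<noteq> [] \<Longrightarrow> length (Is \<circ>\<^sub>e Js) = length Is - 1 + length Js"
  by (cases Is; cases Js) (auto simp: expr_concat_def)

lemma expr_concat_nth_left: "i < length Is \<Longrightarrow> (Is \<circ>\<^sub>e Js) ! i = Is ! i"
  by (simp add: expr_concat_def nth_append)

lemma expr_concat_nth_right:
  assumes "Is \<noteq> []" "last Is = hd Js" "j < length Js"
  shows "(Is \<circ>\<^sub>e Js) ! (length Is - 1 + j) = Js ! j"
proof (cases j)
  case 0
  then show ?thesis
    using assms last_conv_nth[OF assms(1)] hd_conv_nth[of Js] by (simp add: expr_concat_def nth_append)
next
  case (Suc k)
  then have eq: "length Is - 1 + j = length Is + k" using assms(1) by (cases Is) auto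
  have "(Is \<circ>\<^sub>e Js) ! (length Is + k) = Js ! j"
    using Suc assms(3) by (simp add: expr_concat_def nth_append nth_tl)
  then show ?thesis unfolding eq .
qed

lemma expr_concat_last:
  assumes "Is \<noteq> []" "Js \<noteq> []" "last Is = hd Js"
  shows "last (Is \<circ>\<^sub>e Js) = last Js"
  using assms by (cases Js) (auto simp: expr_concat_def)

lemma expr_concat_is_expression:
  assumes Is: "is_expression G S Is" and Js: "is_expression G S Js" and eq: "last Is = hd Js"
  shows "is_expression G S (Is \<circ>\<^sub>e Js)"
proof -
  have ne: "Is \<noteq> []" "Js \<noteq> []" using Is Js by (auto simp: is_expression_def)
  let ?C = "Is \<circ>\<^sub>e Js" and ?a = "length Is - 1"
  let ?step = "\<lambda>I I'. \<exists>s\<in>S. s \<notin> I \<and> I' = insert s I \<or> s \<in> I \<and> I' = I - {s}"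
  have "?step (?C ! i) (?C ! Suc i)" if "Suc i < length ?C" for i
  proof (cases "i < ?a")
    case True
    then have "Suc i < length Is" by simp
    with Is show ?thesis by (simp add: is_expression_def expr_concat_nth_left)
  next
    case False
    then obtain j where j: "i = ?a + j" using le_Suc_ex not_less by blast
    then have "Suc j < length Js" using that expr_concat_length[OF ne] by simp
    with Js show ?thesis
      using expr_concat_nth_right[OF ne(1) eq, of j] expr_concat_nth_right[OF ne(1) eq, of "Suc j"] j
      by (simp add: is_expression_def)
  qed
  moreover have "set ?C \<subseteq> set Is \<union> set Js"
    using ne by (cases Js) (auto simp: expr_concat_def)
  ultimately show ?thesis using Is Js ne unfolding is_expression_def by (auto simp: expr_concat_def)
qed

section \<open>Words and parabolic subgroups\<close>

lemma word_prod_Nil [simp]: "word_prod G [] = \<one>\<^bsub>G\<^esub>"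
  by (simp add: word_prod_def)

lemma word_prod_Cons [simp]: "word_prod G (s # ws) = s \<otimes>\<^bsub>G\<^esub> word_prod G ws"
  by (simp add: word_prod_def)

context coxeter_system
begin

abbreviation len :: "'a \<Rightarrow> nat" where "len \<equiv> cox_length G S"
abbreviation wp :: "'a list \<Rightarrow> 'a" where "wp \<equiv> word_prod G"

lemma S_closed [simp]: "s \<in> S \<Longrightarrow> s \<in> carrier G"
  using S_subset by blast

lemma S_inv [simp]: "s \<in> S \<Longrightarrow> inv s = s"
  using S_involution inv_equality by auto

lemma S_cancel [simp]: "s \<in> S \<Longrightarrow> x \<in> carrier G \<Longrightarrow> s \<otimes> (s \<otimes> x) = x"
  by (simp add: S_involution flip: m_assoc)

lemma S_conj_conj: "s \<in> S \<Longrightarrow> x \<in> carrier G \<Longrightarrow> s \<otimes> (s \<otimes> x \<otimes> s) \<otimes> s = x"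
  by (simp add: m_assoc S_involution)

lemma wp_closed [simp]: "set ws \<subseteq> S \<Longrightarrow> wp ws \<in> carrier G"
  by (induction ws) auto

lemma wp_append: "set us \<subseteq> S \<Longrightarrow> set vs \<subseteq> S \<Longrightarrow> wp (us @ vs) = wp us \<otimes> wp vs"
  by (induction us) (auto simp: m_assoc)

lemma wp_rev: "set ws \<subseteq> S \<Longrightarrow> wp (rev ws) = inv (wp ws)"
  by (induction ws) (auto simp: wp_append inv_mult_group)

lemma generate_eq_words:
  assumes "I \<subseteq> S" shows "generate G I = wp ` {ws. set ws \<subseteq> I}"
proof (intro equalityI subsetI)
  fix x assume "x \<in> generate G I"
  then show "x \<in> wp ` {ws. set ws \<subseteq> I}"
  proof induction
    case one show ?case by (rule image_eqI[of _ _ "[]"]) auto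
  next
    case (incl h) with assms show ?case
      by (intro image_eqI[of _ _ "[h]"]) (auto simp: subset_iff)
  next
    case (inv h) with assms show ?case
      by (intro image_eqI[of _ _ "[h]"]) (auto simp: subset_iff)
  next
    case (eng h1 h2)
    then obtain us vs where "h1 = wp us" "set us \<subseteq> I" "h2 = wp vs" "set vs \<subseteq> I" by auto
    with assms show ?case
      by (intro image_eqI[of _ _ "us @ vs"]) (auto simp: wp_append)
  qed
next
  fix x assume "x \<in> wp ` {ws. set ws \<subseteq> I}"
  then obtain ws where "x = wp ws" "set ws \<subseteq> I" by auto
  then show "x \<in> generate G I"
    by (induction ws arbitrary: x) (auto intro: generate.intros)
qed

section \<open>Reflections of a word and the deletion property\<close>

text \<open>
  For a word \<open>s\<^sub>1 \<dots> s\<^sub>r\<close> the \<open>i\<close>-th entry is the reflection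
  \<open>s\<^sub>1 \<dots> s\<^sub>i \<dots> s\<^sub>1\<close>; multiplying by it from the left deletes the \<open>i\<close>-th letter. For a reduced word
  these are the left inversions of the element.
\<close>

primrec refl_list :: "'a list \<Rightarrow> 'a list" where
  "refl_list [] = []"
| "refl_list (s # ws) = s # map (\<lambda>t. s \<otimes> t \<otimes> s) (refl_list ws)"

lemma length_refl_list [simp]: "length (refl_list ws) = length ws"
  by (induction ws) auto

lemma refl_list_closed: "set ws \<subseteq> S \<Longrightarrow> set (refl_list ws) \<subseteq> carrier G"
  by (induction ws) auto

lemma refl_list_append:
  assumes "set us \<subseteq> S" "set vs \<subseteq> S"
  shows "refl_list (us @ vs) = refl_list us @ map (\<lambda>t. wp us \<otimes> t \<otimes> inv (wp us)) (refl_list vs)"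
  using assms(1)
proof (induction us)
  case Nil
  have "map (\<lambda>t. \<one> \<otimes> t \<otimes> inv \<one>) (refl_list vs) = refl_list vs"
    using refl_list_closed[OF assms(2)] by (intro map_idI) auto
  then show ?case by simp
next
  case (Cons s us)
  then show ?case using refl_list_closed[OF assms(2)]
    by (auto simp: m_assoc inv_mult_group subset_iff)
qed

text \<open>
  The odd prefixes of an alternating word are palindromes, and \<open>(s t)\<^sup>i s\<close> lists them in a
  form in which periodicity in \<open>i\<close> can be read off.
\<close>

lemma refl_list_dihedral:
  assumes "s \<in> S" "t \<in> S"
  shows "refl_list (concat (replicate k [s, t])) = map (\<lambda>i. (s \<otimes> t) [^] i \<otimes> s) [0..<2 * k]"
proof (induction k)
  case (Suc k)
  have conj: "s \<otimes> (t \<otimes> ((s \<otimes> t) [^] i \<otimes> s) \<otimes> t) \<otimes> s = (s \<otimes> t) [^] Suc (Suc i) \<otimes> s" for i :: nat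
  proof -
    have "s \<otimes> (t \<otimes> ((s \<otimes> t) [^] i \<otimes> s) \<otimes> t) \<otimes> s = ((s \<otimes> t) \<otimes> (s \<otimes> t) [^] i) \<otimes> (s \<otimes> t) \<otimes> s"
      using assms by (simp add: m_assoc)
    also have "(s \<otimes> t) \<otimes> (s \<otimes> t) [^] i = (s \<otimes> t) [^] Suc i"
      by (rule nat_pow_Suc2[symmetric]) (use assms in auto)
    finally show ?thesis by simp
  qed
  have "[0..<2 * Suc k] = 0 # 1 # map (Suc \<circ> Suc) [0..<2 * k]"
    by (simp add: upt_conv_Cons map_Suc_upt flip: map_map del: upt_Suc)
  then show ?case using Suc conj assms by (simp add: comp_def m_assoc)
qed simp

text \<open>
  The reflections \<open>(s t)\<^sup>i s\<close> repeat after \<open>m = ord (s t)\<close> steps, so the relator of length \<open>2 m\<close>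
  runs through the same list twice. This is what makes parities invariant. If the order is
  infinite, \<open>ord\<close> is \<open>0\<close> and the relator is empty.
\<close>

lemma refl_list_relator:
  assumes "s \<in> S" "t \<in> S" "R = concat (replicate (ord (s \<otimes> t)) [s, t])"
  shows "\<exists>Y. refl_list R = Y @ Y" and "wp R = \<one>"
proof -
  let ?m = "ord (s \<otimes> t)" and ?f = "\<lambda>i::nat. (s \<otimes> t) [^] i \<otimes> s"
  have per: "?f (i + ?m) = ?f i" for i
    using assms by (simp add: pow_ord_eq_1 flip: nat_pow_mult)
  have "[0..<2 * ?m] = [0..<?m] @ map (\<lambda>i. i + ?m) [0..<?m]"
    using upt_add_eq_append[of 0 ?m ?m] by (simp add: map_add_upt mult_2)
  then have "map ?f [0..<2 * ?m] = map ?f [0..<?m] @ map ?f [0..<?m]"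
    using per by (simp add: comp_def)
  then show "\<exists>Y. refl_list R = Y @ Y"
    using refl_list_dihedral[OF assms(1,2)] assms(3) by metis
  have "wp (concat (replicate k [s, t])) = (s \<otimes> t) [^] k" for k
  proof (induction k)
    case (Suc k)
    have "(s \<otimes> t) [^] Suc k = (s \<otimes> t) \<otimes> (s \<otimes> t) [^] k"
      by (rule nat_pow_Suc2) (use assms in auto)
    with Suc assms show ?case by (simp add: m_assoc del: nat_pow_Suc)
  qed simp
  then show "wp R = \<one>" using assms by (simp add: pow_ord_eq_1)
qed

text \<open>
  Both parities are invariants of the presentation: inserting a relator adds an even number of
  letters, and conjugates of a list of the form \<open>Y @ Y\<close> of reflections.
\<close>

lemma coxeter_word_eq_parity:
  assumes "coxeter_word_eq G S u v"
  shows "set u \<subseteq> S \<and> set v \<subseteq> S \<and> even (length u + length v) \<and>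
    (\<forall>t. even (count_list (refl_list u) t + count_list (refl_list v) t))"
  using assms
proof induction
  case (relator u v s t)
  define R where "R = concat (replicate (ord (s \<otimes> t)) [s, t])"
  obtain Y where Y: "refl_list R = Y @ Y"
    using refl_list_relator(1)[OF relator(3,4) R_def] by blast
  have R1: "wp R = \<one>" using refl_list_relator(2)[OF relator(3,4) R_def] .
  have RS: "set R \<subseteq> S" using relator by (auto simp: R_def)
  have v: "map (\<lambda>t. \<one> \<otimes> t \<otimes> inv \<one>) (refl_list v) = refl_list v"
    using refl_list_closed[OF relator(2)] by (intro map_idI) auto
  have "refl_list (R @ v) = Y @ Y @ refl_list v"
    using refl_list_append[OF RS relator(2)] Y R1 v by simp
  moreover have "refl_list (u @ R @ v) =
      refl_list u @ map (\<lambda>t. wp u \<otimes> t \<otimes> inv (wp u)) (refl_list (R @ v))"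
    using RS relator by (intro refl_list_append) auto
  ultimately have "even (count_list (refl_list (u @ R @ v)) r + count_list (refl_list (u @ v)) r)" for r
    using refl_list_append[OF relator(1,2)] by auto
  moreover have "even (length R)"
    using Y by (metis length_refl_list length_append dvd_def mult_2)
  ultimately show ?case using relator RS unfolding R_def[symmetric] by auto
next
  case (sym u v) then show ?case by (auto simp: add.commute)
next
  case (trans u v w)
  have "even (a + c)" if "even (a + b)" "even (b + c)" for a b c :: nat
    using that by presburger
  with trans show ?case by blast
qed simp

text \<open>
  A reflection that occurs exactly once along \<open>u\<close> occurs an odd number of times, hence at least
  once, along any other word for the same element.
\<close>

lemma distinct_refl_list_minimal:
  assumes "set u \<subseteq> S" "set v \<subseteq> S" "wp u = wp v" "distinct (refl_list u)"
  shows "length u \<le> length v"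
proof -
  have "set (refl_list u) \<subseteq> set (refl_list v)"
  proof
    fix t assume "t \<in> set (refl_list u)"
    then have "count_list (refl_list u) t = 1" using assms(4) by (simp add: count_list_eq_length_filter distinct_length_filter)
    moreover have "even (count_list (refl_list u) t + count_list (refl_list v) t)"
      using coxeter_word_eq_parity[OF S_presents[OF assms(1-3)]] by blast
    ultimately have "count_list (refl_list v) t \<noteq> 0" by (metis add.right_neutral odd_one)
    then show "t \<in> set (refl_list v)" by (metis count_notin)
  qed
  then have "card (set (refl_list u)) \<le> card (set (refl_list v))" by (simp add: card_mono)
  also have "\<dots> \<le> length v" by (metis card_length length_refl_list)
  finally show ?thesis using assms(4) by (simp add: distinct_card)
qed

lemma refl_list_delete:
  assumes "set ws \<subseteq> S" "t \<in> set (refl_list ws)"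
  shows "\<exists>vs. subseq vs ws \<and> length ws = Suc (length vs) \<and> t \<otimes> wp ws = wp vs"
  using assms
proof (induction ws arbitrary: t)
  case (Cons s ws)
  show ?case
  proof (cases "t = s")
    case True
    then show ?thesis using Cons.prems by (intro exI[of _ ws]) auto
  next
    case False
    then obtain r where r: "r \<in> set (refl_list ws)" "t = s \<otimes> r \<otimes> s"
      using Cons.prems by auto
    then obtain vs where vs: "subseq vs ws" "length ws = Suc (length vs)" "r \<otimes> wp ws = wp vs"
      using Cons by auto
    have "r \<in> carrier G" using r refl_list_closed Cons.prems by auto
    then have "t \<otimes> wp (s # ws) = s \<otimes> (r \<otimes> wp ws)"
      using Cons.prems r by (simp add: m_assoc)
    with vs show ?thesis by (intro exI[of _ "s # vs"]) auto
  qed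
qed simp

text \<open>
  If the reflections at two places agree, the letters at these places can both be deleted. When
  the first letter \<open>s\<close> is one of the two, the other reflection, seen from the tail, is again \<open>s\<close>.
\<close>

lemma repeated_reflection_deletion:
  assumes "set ws \<subseteq> S" "\<not> distinct (refl_list ws)"
  shows "\<exists>vs. subseq vs ws \<and> length vs < length ws \<and> wp vs = wp ws"
  using assms
proof (induction ws)
  case (Cons s ws)
  show ?case
  proof (cases "distinct (refl_list ws)")
    case False
    then obtain vs where "subseq vs ws" "length vs < length ws" "wp vs = wp ws"
      using Cons by auto
    then show ?thesis by (intro exI[of _ "s # vs"]) auto
  next
    case True
    have s: "s \<in> S" using Cons.prems by simp
    have clo: "set (refl_list ws) \<subseteq> carrier G" using Cons.prems refl_list_closed by auto
    have inj: "inj_on (\<lambda>t. s \<otimes> t \<otimes> s) (set (refl_list ws))"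
      using clo S_conj_conj[OF s] by (intro inj_on_inverseI[of _ "\<lambda>t. s \<otimes> t \<otimes> s"]) auto
    obtain t where t: "t \<in> set (refl_list ws)" "s = s \<otimes> t \<otimes> s"
      using Cons.prems True inj by (auto simp: distinct_map)
    then have "t = s" using S_conj_conj[OF s, of t] clo s by (auto simp: S_involution)
    with t refl_list_delete[of ws s] Cons.prems obtain vs
      where "subseq vs ws" "length ws = Suc (length vs)" "s \<otimes> wp ws = wp vs" by auto
    then show ?thesis by (intro exI[of _ vs]) auto
  qed
qed simp

section \<open>The length function\<close>

lemma subseq_subset: "subseq vs ws \<Longrightarrow> set ws \<subseteq> A \<Longrightarrow> set vs \<subseteq> A"
  by (induction rule: list_emb.induct) auto

lemma carrier_eq_words: "carrier G = wp ` {ws. set ws \<subseteq> S}"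
  using generate_eq_words[of S] S_generates by simp

lemma len_le: "set ws \<subseteq> S \<Longrightarrow> len (wp ws) \<le> length ws"
  unfolding cox_length_def by (rule Least_le) auto

lemma reduced_word_exists:
  assumes "x \<in> carrier G"
  obtains ws where "set ws \<subseteq> S" "length ws = len x" "wp ws = x"
proof -
  have "\<exists>n ws. set ws \<subseteq> S \<and> length ws = n \<and> wp ws = x"
    using assms carrier_eq_words by auto
  from LeastI_ex[OF this] show thesis using that unfolding cox_length_def by blast
qed

lemma reduced_subword:
  assumes "set ws \<subseteq> S"
  shows "\<exists>vs. subseq vs ws \<and> wp vs = wp ws \<and> length vs = len (wp ws)"
  using assms
proof (induction ws rule: length_induct)
  case (1 ws)
  show ?case
  proof (cases "distinct (refl_list ws)")
    case True
    obtain us where "set us \<subseteq> S" "length us = len (wp ws)" "wp us = wp ws"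
      using reduced_word_exists[of "wp ws"] 1(2) by auto
    with True 1 distinct_refl_list_minimal[of ws us] len_le[of ws]
    show ?thesis by (intro exI[of _ ws]) auto
  next
    case False
    then obtain vs where "subseq vs ws" "length vs < length ws" "wp vs = wp ws"
      using repeated_reflection_deletion 1 by blast
    moreover have "set vs \<subseteq> S" using calculation(1) 1(2) by (rule subseq_subset)
    moreover obtain us where "subseq us vs" "wp us = wp vs" "length us = len (wp vs)"
      using 1(1) calculation by blast
    ultimately show ?thesis using subseq_order.order_trans by (intro exI[of _ us]) auto
  qed
qed

lemma generate_reduced_word:
  assumes "I \<subseteq> S" "x \<in> generate G I"
  obtains ws where "set ws \<subseteq> I" "length ws = len x" "wp ws = x"
proof -
  obtain us where "set us \<subseteq> I" "x = wp us" using assms generate_eq_words by auto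
  with reduced_subword[of us] assms obtain vs
    where "subseq vs us" "wp vs = x" "length vs = len x" by auto
  moreover have "set vs \<subseteq> I" using calculation(1) \<open>set us \<subseteq> I\<close> by (rule subseq_subset)
  ultimately show ?thesis using that by blast
qed

lemma len_one [simp]: "len \<one> = 0"
  using len_le[of "[]"] by simp

lemma len_eq_0: "x \<in> carrier G \<Longrightarrow> len x = 0 \<longleftrightarrow> x = \<one>"
  by (rule reduced_word_exists[of x]) auto

lemma len_mult_le:
  assumes "x \<in> carrier G" "y \<in> carrier G" shows "len (x \<otimes> y) \<le> len x + len y"
proof -
  obtain us where "set us \<subseteq> S" "length us = len x" "wp us = x"
    using reduced_word_exists[OF assms(1)] .
  moreover obtain vs where "set vs \<subseteq> S" "length vs = len y" "wp vs = y"
    using reduced_word_exists[OF assms(2)] .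
  ultimately show ?thesis using len_le[of "us @ vs"] by (auto simp: wp_append)
qed

lemma len_inv_le: "x \<in> carrier G \<Longrightarrow> len (inv x) \<le> len x"
  by (erule reduced_word_exists) (use len_le[of "rev _"] in \<open>force simp: wp_rev\<close>)

lemma len_inv [simp]: "x \<in> carrier G \<Longrightarrow> len (inv x) = len x"
  using len_inv_le[of x] len_inv_le[of "inv x"] by auto

lemma len_simple_le: "s \<in> S \<Longrightarrow> len s \<le> 1"
  using len_le[of "[s]"] by simp

lemma len_simple [simp]: "s \<in> S \<Longrightarrow> len s = 1"
  using len_simple_le[of s] len_eq_0[of s] S_neq_one[of s] by auto

text \<open>
  The parity of the number of letters depends only on the element.
\<close>

lemma len_simple_mult_neq:
  assumes "s \<in> S" "x \<in> carrier G" shows "len (s \<otimes> x) \<noteq> len x"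
proof
  assume eq: "len (s \<otimes> x) = len x"
  obtain us where u: "set us \<subseteq> S" "length us = len x" "wp us = x"
    using reduced_word_exists[OF assms(2)] .
  obtain vs where v: "set vs \<subseteq> S" "length vs = len (s \<otimes> x)" "wp vs = s \<otimes> x"
    using reduced_word_exists[of "s \<otimes> x"] assms by auto
  have "coxeter_word_eq G S (s # us) vs" using u v assms by (intro S_presents) auto
  from coxeter_word_eq_parity[OF this] u v eq show False by auto
qed

lemma len_simple_mult:
  assumes "s \<in> S" "x \<in> carrier G"
  shows "len (s \<otimes> x) = Suc (len x) \<or> len x = Suc (len (s \<otimes> x))"
proof -
  have "len (s \<otimes> x) \<le> 1 + len x" using len_mult_le[of s x] assms by simp
  moreover have "len x \<le> 1 + len (s \<otimes> x)" using len_mult_le[of s "s \<otimes> x"] assms by simp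
  ultimately show ?thesis using len_simple_mult_neq[OF assms] by auto
qed

lemma generate_len_1:
  assumes "I \<subseteq> S" "x \<in> generate G I" "len x = 1" shows "x \<in> I"
proof -
  obtain ws where "set ws \<subseteq> I" "length ws = len x" "wp ws = x"
    using generate_reduced_word[OF assms(1,2)] .
  then show ?thesis using assms by (auto simp: length_Suc_conv subset_iff)
qed

lemma generate_closed: "I \<subseteq> S \<Longrightarrow> x \<in> generate G I \<Longrightarrow> x \<in> carrier G"
  using S_subset generate_in_carrier by blast

lemma generate_first_letter:
  assumes "I \<subseteq> S" "x \<in> generate G I" "x \<noteq> \<one>"
  shows "\<exists>s y. s \<in> I \<and> y \<in> generate G I \<and> x = s \<otimes> y \<and> len x = Suc (len y)"
proof -
  obtain ws where ws: "set ws \<subseteq> I" "length ws = len x" "wp ws = x"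
    using generate_reduced_word[OF assms(1,2)] .
  then obtain s vs where vs: "ws = s # vs" using assms by (cases ws) auto
  have "len (wp vs) \<le> length vs" using ws vs assms by (intro len_le) auto
  moreover have "len x \<le> 1 + len (wp vs)"
    using len_mult_le[of s "wp vs"] ws vs assms by fastforce
  ultimately have "len x = Suc (len (wp vs))" using ws vs by auto
  moreover have "wp vs \<in> generate G I" using generate_eq_words assms ws vs by auto
  ultimately show ?thesis using ws vs by auto
qed

text \<open>
  Concatenate reduced words for the three factors and delete letters until the result is reduced;
  what remains of each block is a reduced word for the new factor. The alternatives at the end say
  that a block either loses letters or survives unchanged, which turns a bound on
  lengths into an equality of factors.
\<close>

lemma reduced_factorisation:
  assumes "J \<subseteq> S" "I \<subseteq> S" "a \<in> generate G J" "d \<in> carrier G" "b \<in> generate G I"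
  obtains a' d' b' where "a' \<in> generate G J" "d' \<in> carrier G" "b' \<in> generate G I"
    "a \<otimes> d \<otimes> b = a' \<otimes> d' \<otimes> b'" "len (a \<otimes> d \<otimes> b) = len a' + len d' + len b'"
    "len a' < len a \<or> a' = a" "len d' < len d \<or> d' = d" "len b' < len b \<or> b' = b"
proof -
  obtain us where us: "set us \<subseteq> J" "length us = len a" "wp us = a"
    using generate_reduced_word[OF assms(1,3)] .
  obtain vs where vs: "set vs \<subseteq> S" "length vs = len d" "wp vs = d"
    using reduced_word_exists[OF assms(4)] .
  obtain ws where ws: "set ws \<subseteq> I" "length ws = len b" "wp ws = b"
    using generate_reduced_word[OF assms(2,5)] .
  have sub: "set us \<subseteq> S" "set ws \<subseteq> S" using us ws assms by auto
  let ?x = "a \<otimes> d \<otimes> b"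
  have x: "wp (us @ vs @ ws) = ?x"
    using us vs ws sub generate_closed[OF assms(1,3)] generate_closed[OF assms(2,5)] assms(4) by (simp add: wp_append m_assoc)
  obtain rs where rs: "subseq rs (us @ vs @ ws)" "wp rs = ?x" "length rs = len ?x"
    using reduced_subword[of "us @ vs @ ws"] x sub vs by auto
  from rs(1) obtain us' rs' where s1: "rs = us' @ rs'" "subseq us' us" "subseq rs' (vs @ ws)"
    by (auto simp: subseq_append_iff)
  from s1(3) obtain vs' ws' where s2: "rs' = vs' @ ws'" "subseq vs' vs" "subseq ws' ws"
    by (auto simp: subseq_append_iff)
  have sets: "set us' \<subseteq> J" "set vs' \<subseteq> S" "set ws' \<subseteq> I"
    using subseq_subset[OF s1(2) us(1)] subseq_subset[OF s2(2) vs(1)] subseq_subset[OF s2(3) ws(1)] by simp_all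
  have setsS: "set us' \<subseteq> S" "set ws' \<subseteq> S" using sets assms by auto
  have lens: "len (wp us') \<le> length us'" "len (wp vs') \<le> length vs'" "len (wp ws') \<le> length ws'"
    using sets setsS by (auto intro: len_le)
  have eq: "?x = wp us' \<otimes> wp vs' \<otimes> wp ws'"
    using rs(2) s1 s2 sets setsS by (simp add: wp_append m_assoc)
  have "len ?x \<le> len (wp us') + len (wp vs') + len (wp ws')"
    unfolding eq using len_mult_le[of "wp us' \<otimes> wp vs'" "wp ws'"] len_mult_le[of "wp us'" "wp vs'"] sets setsS by simp
  with lens rs(3) s1 s2 have L: "len (wp us') = length us'" "len (wp vs') = length vs'"
    "len (wp ws') = length ws'" "len ?x = len (wp us') + len (wp vs') + len (wp ws')" by auto
  have short: "length xs < length ys \<or> xs = ys" if "subseq xs ys" for xs ys :: "'a list"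
    using that by (metis list_emb_length nat_less_le subseq_same_length)
  show thesis
  proof (rule that)
    show "wp us' \<in> generate G J" "wp ws' \<in> generate G I"
      using sets generate_eq_words assms by auto
    show "wp vs' \<in> carrier G" using sets by simp
    show "len (wp us') < len a \<or> wp us' = a" "len (wp vs') < len d \<or> wp vs' = d"
      "len (wp ws') < len b \<or> wp ws' = b"
      using short[OF s1(2)] short[OF s2(2)] short[OF s2(3)] L us vs ws by auto
  qed (use eq L in auto)
qed

section \<open>Descents and double cosets\<close>

definition ascends_left :: "'a set \<Rightarrow> 'a \<Rightarrow> bool" where
  "ascends_left J x \<longleftrightarrow> (\<forall>s\<in>J. len x < len (s \<otimes> x))"

definition ascends_right :: "'a set \<Rightarrow> 'a \<Rightarrow> bool" where
  "ascends_right I x \<longleftrightarrow> (\<forall>s\<in>I. len x < len (x \<otimes> s))"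

definition descends_left :: "'a set \<Rightarrow> 'a \<Rightarrow> bool" where
  "descends_left J x \<longleftrightarrow> (\<forall>s\<in>J. len (s \<otimes> x) < len x)"

definition descends_right :: "'a set \<Rightarrow> 'a \<Rightarrow> bool" where
  "descends_right I x \<longleftrightarrow> (\<forall>s\<in>I. len (x \<otimes> s) < len x)"

lemma len_mult_simple_inv:
  assumes "s \<in> S" "x \<in> carrier G" shows "len (x \<otimes> s) = len (s \<otimes> inv x)"
  using len_inv[of "x \<otimes> s"] assms by (simp add: inv_mult_group)

lemma ascends_right_inv: "I \<subseteq> S \<Longrightarrow> x \<in> carrier G \<Longrightarrow> ascends_right I x = ascends_left I (inv x)"
  unfolding ascends_right_def ascends_left_def
  by (intro ball_cong refl) (auto simp: len_mult_simple_inv subset_iff)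

lemma descends_right_inv: "I \<subseteq> S \<Longrightarrow> x \<in> carrier G \<Longrightarrow> descends_right I x = descends_left I (inv x)"
  unfolding descends_right_def descends_left_def
  by (intro ball_cong refl) (auto simp: len_mult_simple_inv subset_iff)

abbreviation dcos :: "'a set \<Rightarrow> 'a \<Rightarrow> 'a set \<Rightarrow> 'a set" where
  "dcos J x I \<equiv> generate G J <#> {x} <#> generate G I"

lemma inv_cancel_left [simp]:
  assumes "a \<in> carrier G" "x \<in> carrier G"
  shows "inv a \<otimes> (a \<otimes> x) = x" "a \<otimes> (inv a \<otimes> x) = x"
  using assms by (simp_all flip: m_assoc)

lemma mem_dcos: "y \<in> dcos J x I \<longleftrightarrow> (\<exists>a\<in>generate G J. \<exists>b\<in>generate G I. y = a \<otimes> x \<otimes> b)"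
  by (auto simp: set_mult_def)

lemma generate_mult: "x \<in> generate G I \<Longrightarrow> y \<in> generate G I \<Longrightarrow> x \<otimes> y \<in> generate G I"
  by (rule generate.eng)

lemma generate_inv: "I \<subseteq> S \<Longrightarrow> x \<in> generate G I \<Longrightarrow> inv x \<in> generate G I"
  using S_subset generate_m_inv_closed by blast

lemma dcos_subset:
  assumes "J \<subseteq> S" "I \<subseteq> S" "J' \<subseteq> J" "I' \<subseteq> I" "x \<in> carrier G" "y \<in> dcos J x I"
  shows "dcos J' y I' \<subseteq> dcos J x I"
proof
  fix z assume "z \<in> dcos J' y I'"
  then obtain a b where ab: "a \<in> generate G J" "b \<in> generate G I" "z = a \<otimes> y \<otimes> b"
    using mono_generate[OF assms(3)] mono_generate[OF assms(4)] by (auto simp: mem_dcos)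
  from assms(6) obtain a' b' where ab': "a' \<in> generate G J" "b' \<in> generate G I" "y = a' \<otimes> x \<otimes> b'"
    by (auto simp: mem_dcos)
  have "z = (a \<otimes> a') \<otimes> x \<otimes> (b' \<otimes> b)"
    using ab ab' assms(5) by (simp add: m_assoc generate_closed[OF assms(1)] generate_closed[OF assms(2)])
  then show "z \<in> dcos J x I"
    unfolding mem_dcos using generate_mult ab ab' by blast
qed

lemma dcos_self: "x \<in> carrier G \<Longrightarrow> x \<in> dcos J x I"
  by (auto simp: mem_dcos intro!: bexI[of _ \<one>] generate.one)

lemma dcos_closed: "J \<subseteq> S \<Longrightarrow> I \<subseteq> S \<Longrightarrow> x \<in> carrier G \<Longrightarrow> y \<in> dcos J x I \<Longrightarrow> y \<in> carrier G"
  by (auto simp: mem_dcos generate_closed)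

lemma dcos_eq:
  assumes "J \<subseteq> S" "I \<subseteq> S" "x \<in> carrier G" "y \<in> dcos J x I"
  shows "dcos J y I = dcos J x I"
proof
  show "dcos J y I \<subseteq> dcos J x I" using assms by (intro dcos_subset) auto
  obtain a b where ab: "a \<in> generate G J" "b \<in> generate G I" "y = a \<otimes> x \<otimes> b"
    using assms by (auto simp: mem_dcos)
  have "a \<in> carrier G" "b \<in> carrier G" using ab assms generate_closed by blast+
  then have "x = inv a \<otimes> y \<otimes> inv b" using ab assms(3) by (simp add: m_assoc)
  then have "x \<in> dcos J y I" unfolding mem_dcos using ab generate_inv assms by blast
  then show "dcos J x I \<subseteq> dcos J y I"
    using assms dcos_closed[OF assms] by (intro dcos_subset) auto
qed

lemma dcos_sym:
  assumes "J \<subseteq> S" "I \<subseteq> S" "x \<in> carrier G" "y \<in> dcos J x I"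
  shows "x \<in> dcos J y I"
  unfolding dcos_eq[OF assms] by (rule dcos_self[OF assms(3)])

lemma dcos_trans:
  assumes "J \<subseteq> S" "I \<subseteq> S" "x \<in> carrier G" "y \<in> dcos J x I" "z \<in> dcos J y I"
  shows "z \<in> dcos J x I"
  using assms(5) unfolding dcos_eq[OF assms(1-4)] .

lemma double_cosets_iff: "p \<in> double_cosets G J I \<longleftrightarrow> (\<exists>x\<in>carrier G. p = dcos J x I)"
  by (auto simp: double_cosets_def)

lemma double_coset_eq:
  assumes "J \<subseteq> S" "I \<subseteq> S" "p \<in> double_cosets G J I" "x \<in> p"
  shows "x \<in> carrier G" "p = dcos J x I"
proof -
  obtain y where y: "y \<in> carrier G" "p = dcos J y I"
    using assms(3) unfolding double_cosets_iff by (elim bexE)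
  have "x \<in> dcos J y I" using assms(4) y(2) by simp
  then show "x \<in> carrier G" "p = dcos J x I"
    unfolding y(2) by (rule dcos_closed[OF assms(1,2) y(1)], rule dcos_eq[OF assms(1,2) y(1), symmetric])
qed

lemma the_double_coset:
  assumes "J \<subseteq> S" "I \<subseteq> S" "x \<in> carrier G"
  shows "(THE q. q \<in> double_cosets G J I \<and> x \<in> q) = dcos J x I"
proof (rule the_equality)
  show "dcos J x I \<in> double_cosets G J I \<and> x \<in> dcos J x I"
    using assms dcos_self by (auto simp: double_cosets_iff)
  fix q assume "q \<in> double_cosets G J I \<and> x \<in> q"
  then show "q = dcos J x I" by (intro double_coset_eq(2)[OF assms(1,2)]) simp_all
qed

lemma finite_dcos:
  assumes "finite (generate G J)" "finite (generate G I)" shows "finite (dcos J x I)"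
proof -
  have "dcos J x I \<subseteq> (\<lambda>(a, b). a \<otimes> x \<otimes> b) ` (generate G J \<times> generate G I)"
    by (auto simp: mem_dcos)
  then show ?thesis using assms by (meson finite_SigmaI finite_imageI finite_subset)
qed

section \<open>Minimal elements of double cosets\<close>

text \<open>
  Otherwise the first letter of a reduced word for \<open>a\<close> is a left descent of \<open>a y\<close>.
\<close>

lemma ascending_left_factor:
  assumes "J \<subseteq> S" "a \<in> generate G J" "y \<in> carrier G" "ascends_left J (a \<otimes> y)"
    and "len (a \<otimes> y) = len a + len y"
  shows "a = \<one>"
proof (rule ccontr)
  assume "a \<noteq> \<one>"
  then obtain s c where sc: "s \<in> J" "c \<in> generate G J" "a = s \<otimes> c" "len a = Suc (len c)"
    using generate_first_letter assms by blast
  have c: "c \<in> carrier G" "s \<in> S" using sc assms generate_closed by auto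
  have "s \<otimes> (a \<otimes> y) = c \<otimes> y" using sc c assms(3) by (simp add: m_assoc)
  then have "len (s \<otimes> (a \<otimes> y)) \<le> len c + len y" using len_mult_le c assms by simp
  then show False using assms(4,5) sc by (auto simp: ascends_left_def)
qed

lemma ascending_right_factor:
  assumes "I \<subseteq> S" "b \<in> generate G I" "y \<in> carrier G" "ascends_right I (y \<otimes> b)"
    and "len (y \<otimes> b) = len y + len b"
  shows "b = \<one>"
proof -
  have b: "b \<in> carrier G" using assms generate_closed by auto
  have yb: "inv (y \<otimes> b) = inv b \<otimes> inv y" using assms b by (simp add: inv_mult_group)
  have "inv b = \<one>"
  proof (rule ascending_left_factor[OF assms(1)])
    show "ascends_left I (inv b \<otimes> inv y)"
      using ascends_right_inv[of I "y \<otimes> b"] assms b yb by simp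
    show "len (inv b \<otimes> inv y) = len (inv b) + len (inv y)"
      using assms b len_inv[of "y \<otimes> b"] yb by simp
  qed (use assms generate_inv in auto)
  then show ?thesis using b by (simp add: inv_eq_1_iff)
qed

text \<open>
  For \<open>d\<close> of minimal length in the double coset, reducing \<open>a d b\<close> cannot shorten the middle factor,
  because what remains of it is still in the double coset.
\<close>

lemma shortest_factorisation:
  assumes "J \<subseteq> S" "I \<subseteq> S" "x \<in> carrier G"
  shows "\<exists>d\<in>dcos J x I. \<forall>u\<in>dcos J x I. \<exists>a\<in>generate G J. \<exists>b\<in>generate G I.
    u = a \<otimes> d \<otimes> b \<and> len u = len a + len d + len b"
proof -
  obtain d where d: "d \<in> dcos J x I" "\<forall>u\<in>dcos J x I. len d \<le> len u"
    using ex_has_least_nat[of "\<lambda>u. u \<in> dcos J x I" x len] dcos_self assms by blast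
  have dc: "d \<in> carrier G" using d dcos_closed assms by blast
  show ?thesis
  proof (intro bexI[OF _ d(1)] ballI)
    fix u assume u: "u \<in> dcos J x I"
    then have "u \<in> dcos J d I" unfolding dcos_eq[OF assms d(1)] .
    then obtain a b where ab: "a \<in> generate G J" "b \<in> generate G I" "u = a \<otimes> d \<otimes> b"
      unfolding mem_dcos by blast
    from reduced_factorisation[OF assms(1,2) ab(1) dc ab(2)] obtain a' d' b' where
      f: "a' \<in> generate G J" "d' \<in> carrier G" "b' \<in> generate G I" "u = a' \<otimes> d' \<otimes> b'"
      "len u = len a' + len d' + len b'" "len d' < len d \<or> d' = d"
      unfolding ab(3) by metis
    have "u \<in> dcos J d' I" using f by (auto simp: mem_dcos)
    then have "d' \<in> dcos J u I" by (rule dcos_sym[OF assms(1,2) f(2)])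
    then have "d' \<in> dcos J x I" by (rule dcos_trans[OF assms u])
    then have "len d \<le> len d'" using d(2) by blast
    then have "d' = d" using f(6) by simp
    then show "\<exists>a\<in>generate G J. \<exists>b\<in>generate G I. u = a \<otimes> d \<otimes> b \<and> len u = len a + len d + len b"
      using f by blast
  qed
qed

text \<open>
  An element without descents is the shortest one \<open>e\<close> of its double coset: in \<open>d = a e b\<close>
  with additive lengths, nontrivial outer factors would give \<open>d\<close> a descent.
\<close>

lemma ascending_factorisation:
  assumes "J \<subseteq> S" "I \<subseteq> S" "d \<in> carrier G" "ascends_left J d" "ascends_right I d" "u \<in> dcos J d I"
  obtains a b where "a \<in> generate G J" "b \<in> generate G I"
    "u = a \<otimes> d \<otimes> b" "len u = len a + len d + len b"
proof -
  obtain e where e: "e \<in> dcos J d I" "\<forall>u\<in>dcos J d I. \<exists>a\<in>generate G J. \<exists>b\<in>generate G I.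
    u = a \<otimes> e \<otimes> b \<and> len u = len a + len e + len b"
    using shortest_factorisation[OF assms(1-3)] by blast
  obtain a b where ab: "a \<in> generate G J" "b \<in> generate G I"
    "d = a \<otimes> e \<otimes> b" "len d = len a + len e + len b"
    using e(2) dcos_self[OF assms(3)] by blast
  have c: "a \<in> carrier G" "b \<in> carrier G" "e \<in> carrier G"
    using generate_closed[OF assms(1) ab(1)] generate_closed[OF assms(2) ab(2)]
      dcos_closed[OF assms(1-3) e(1)] .
  have "a = \<one>"
  proof (rule ascending_left_factor[OF assms(1) ab(1), of "e \<otimes> b"])
    show "len (a \<otimes> (e \<otimes> b)) = len a + len (e \<otimes> b)"
      using ab c len_mult_le[of e b] len_mult_le[of a "e \<otimes> b"] by (simp add: m_assoc)
  qed (use ab c assms(4) in \<open>auto simp: m_assoc\<close>)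
  moreover have "b = \<one>"
  proof (rule ascending_right_factor[OF assms(2) ab(2), of "a \<otimes> e"])
    show "len (a \<otimes> e \<otimes> b) = len (a \<otimes> e) + len b"
      using ab c len_mult_le[of a e] len_mult_le[of "a \<otimes> e" b] by simp
  qed (use ab c assms(5) in auto)
  ultimately have "d = e" using ab c by simp
  then show thesis using e(2) assms(6) that by blast
qed

text \<open>
  The one-sided case is the two-sided one for double cosets of \<open>W\<^sub>J\<close> and the trivial group.
\<close>

lemma len_mult_ascends_left:
  assumes "J \<subseteq> S" "x \<in> carrier G" "ascends_left J x" "a \<in> generate G J"
  shows "len (a \<otimes> x) = len a + len x"
proof -
  have a: "a \<in> carrier G" using assms generate_closed by blast
  have "a \<otimes> x \<in> dcos J x {}"
    using assms a unfolding mem_dcos by (intro bexI[of _ a] bexI[of _ \<one>]) (auto intro: generate.one)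
  then obtain c b where cb: "c \<in> generate G J" "b \<in> generate G {}"
    "a \<otimes> x = c \<otimes> x \<otimes> b" "len (a \<otimes> x) = len c + len x + len b"
    using ascending_factorisation[of J "{}" x "a \<otimes> x"] assms(1-3)
    unfolding ascends_right_def by blast
  have "b = \<one>" using cb(2) by (simp add: generate_empty)
  then have "a = c" using cb assms a generate_closed[OF assms(1) cb(1)] by simp
  then show ?thesis using cb \<open>b = \<one>\<close> by simp
qed

lemma len_mult_ascends_right:
  assumes "I \<subseteq> S" "x \<in> carrier G" "ascends_right I x" "b \<in> generate G I"
  shows "len (x \<otimes> b) = len x + len b"
proof -
  have b: "b \<in> carrier G" using assms generate_closed by blast
  have "len (inv b \<otimes> inv x) = len (inv b) + len (inv x)"
    using assms ascends_right_inv generate_inv by (intro len_mult_ascends_left) auto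
  moreover have "len (x \<otimes> b) = len (inv b \<otimes> inv x)"
    using len_inv[of "x \<otimes> b"] assms b by (simp add: inv_mult_group)
  ultimately show ?thesis using assms b by simp
qed

lemma bruhat_le_len:
  assumes "bruhat_le G S u v" shows "u = v \<or> len u < len v"
  using assms unfolding bruhat_le_def by (induction rule: rtrancl_induct) auto

lemma bruhat_le_right:
  assumes "s \<in> S" "x \<in> carrier G" "len x < len (x \<otimes> s)" shows "bruhat_le G S x (x \<otimes> s)"
proof -
  have "s = \<one> \<otimes> s \<otimes> inv \<one>" using assms by simp
  then have "s \<in> reflections G S" unfolding reflections_def using assms by blast
  then show ?thesis unfolding bruhat_le_def using assms by (intro r_into_rtrancl) blast
qed

text \<open>
  The Bruhat relation multiplies by reflections on the right, so \<open>s x\<close> is written as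
  \<open>x t\<close> with \<open>t = x\<^sup>-\<^sup>1 s x\<close>.
\<close>

lemma bruhat_le_left:
  assumes "s \<in> S" "x \<in> carrier G" "len x < len (s \<otimes> x)" shows "bruhat_le G S x (s \<otimes> x)"
proof -
  define t where "t = inv x \<otimes> s \<otimes> inv (inv x)"
  have "t \<in> reflections G S" unfolding reflections_def t_def using assms by blast
  moreover have "s \<otimes> x = x \<otimes> t" using assms by (simp add: t_def m_assoc)
  ultimately show ?thesis unfolding bruhat_le_def using assms by (intro r_into_rtrancl) auto
qed

lemma dcos_step:
  assumes "J \<subseteq> S" "I \<subseteq> S" "p \<in> double_cosets G J I" "x \<in> p"
  shows "s \<in> J \<Longrightarrow> s \<otimes> x \<in> p" and "s \<in> I \<Longrightarrow> x \<otimes> s \<in> p"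
proof -
  have x: "x \<in> carrier G" "p = dcos J x I" using double_coset_eq[OF assms] .
  show "s \<in> J \<Longrightarrow> s \<otimes> x \<in> p"
    unfolding x(2) mem_dcos using assms x(1)
    by (intro bexI[of _ s] bexI[of _ \<one>]) (auto intro: generate.one generate.incl)
  show "s \<in> I \<Longrightarrow> x \<otimes> s \<in> p"
    unfolding x(2) mem_dcos using assms x(1)
    by (intro bexI[of _ \<one>] bexI[of _ s]) (auto intro: generate.one generate.incl)
qed

lemma len_mult_simple_neq:
  assumes "s \<in> S" "x \<in> carrier G" shows "len (x \<otimes> s) \<noteq> len x"
  using len_simple_mult_neq[of s "inv x"] len_mult_simple_inv[OF assms] assms by simp

lemma bruhat_minimal_ascends:
  assumes "J \<subseteq> S" "I \<subseteq> S" "p \<in> double_cosets G J I" "x \<in> p"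
    and min: "\<forall>y\<in>p. bruhat_le G S y x \<longrightarrow> y = x"
  shows "ascends_left J x" "ascends_right I x"
proof -
  have x: "x \<in> carrier G" using double_coset_eq(1)[OF assms(1-4)] .
  show "ascends_left J x" unfolding ascends_left_def
  proof
    fix s assume s: "s \<in> J"
    then have sS: "s \<in> S" using assms by auto
    have "\<not> len (s \<otimes> x) < len x"
    proof
      assume l: "len (s \<otimes> x) < len x"
      then have "bruhat_le G S (s \<otimes> x) x"
        using bruhat_le_left[of s "s \<otimes> x"] sS x by simp
      then show False using min dcos_step(1)[OF assms(1-4) s] l by fastforce
    qed
    then show "len x < len (s \<otimes> x)" using len_simple_mult_neq[OF sS x] by simp
  qed
  show "ascends_right I x" unfolding ascends_right_def
  proof
    fix s assume s: "s \<in> I"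
    then have sS: "s \<in> S" using assms by auto
    have "\<not> len (x \<otimes> s) < len x"
    proof
      assume l: "len (x \<otimes> s) < len x"
      then have "bruhat_le G S (x \<otimes> s) x"
        using bruhat_le_right[of s "x \<otimes> s"] sS x by (simp add: m_assoc S_involution)
      then show False using min dcos_step(2)[OF assms(1-4) s] l by fastforce
    qed
    then show "len x < len (x \<otimes> s)" using len_mult_simple_neq[OF sS x] by simp
  qed
qed

text \<open>
  Additivity of lengths makes \<open>d\<close> strictly shorter than every other element of its double coset,
  and length strictly increases along the Bruhat order.
\<close>

lemma min_elt_dcos:
  assumes "J \<subseteq> S" "I \<subseteq> S" "d \<in> carrier G" "ascends_left J d" "ascends_right I d"
  shows "min_elt G S (dcos J d I) = d"
proof -
  have least: "u = d \<or> len d < len u" if u: "u \<in> dcos J d I" for u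
  proof -
    obtain a b where ab: "a \<in> generate G J" "b \<in> generate G I"
      "u = a \<otimes> d \<otimes> b" "len u = len a + len d + len b"
      using ascending_factorisation[OF assms u] .
    moreover have "a \<in> carrier G" "b \<in> carrier G"
      using generate_closed[OF assms(1) ab(1)] generate_closed[OF assms(2) ab(2)] .
    ultimately show ?thesis using assms(3) len_eq_0 by (cases "len a = 0 \<and> len b = 0") auto
  qed
  have dc: "dcos J d I \<in> double_cosets G J I" using assms by (auto simp: double_cosets_iff)
  show ?thesis unfolding min_elt_def
  proof (rule the_equality)
    show "d \<in> dcos J d I \<and> (\<forall>y\<in>dcos J d I. bruhat_le G S y d \<longrightarrow> y = d)"
      using dcos_self assms least bruhat_le_len by fastforce
    fix x assume x: "x \<in> dcos J d I \<and> (\<forall>y\<in>dcos J d I. bruhat_le G S y x \<longrightarrow> y = x)"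
    then have asc: "ascends_left J x" "ascends_right I x"
      using bruhat_minimal_ascends[OF assms(1,2) dc] by blast+
    obtain a b where ab: "a \<in> generate G J" "b \<in> generate G I"
      "d = a \<otimes> x \<otimes> b" "len d = len a + len x + len b"
      using x by (elim conjE) (rule ascending_factorisation[OF assms(1,2) dcos_closed[OF assms(1-3)] asc
        dcos_sym[OF assms(1-3)]])
    then show "x = d" using least[of x] x by auto
  qed
qed

lemma min_elt_double_coset:
  assumes "J \<subseteq> S" "I \<subseteq> S" "p \<in> double_cosets G J I"
  shows "min_elt G S p \<in> carrier G" "min_elt G S p \<in> p" "p = dcos J (min_elt G S p) I"
    "ascends_left J (min_elt G S p)" "ascends_right I (min_elt G S p)"
proof -
  obtain x where x: "x \<in> carrier G" "p = dcos J x I" using assms by (auto simp: double_cosets_iff)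
  obtain d where d: "d \<in> p" "\<forall>u\<in>p. len d \<le> len u"
    using ex_has_least_nat[of "\<lambda>u. u \<in> p" x len] dcos_self x by blast
  have dp: "d \<in> carrier G" "p = dcos J d I" using double_coset_eq[OF assms d(1)] .
  have asc: "ascends_left J d" "ascends_right I d"
    using bruhat_minimal_ascends[OF assms d(1)] d(2) bruhat_le_len by fastforce+
  have "min_elt G S p = d" using min_elt_dcos[OF assms(1,2) dp(1) asc] dp(2) by simp
  then show "min_elt G S p \<in> carrier G" "min_elt G S p \<in> p" "p = dcos J (min_elt G S p) I"
    "ascends_left J (min_elt G S p)" "ascends_right I (min_elt G S p)"
    using d dp asc by auto
qed

section \<open>Maximal elements of double cosets\<close>

text \<open>
  Exactly one letter is lost from \<open>x b\<close> when \<open>s\<close> is multiplied on. It cannot be lost from \<open>x\<close>,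
  since that would make \<open>s\<close> a left descent of \<open>x\<close>.
\<close>

lemma exchange_left:
  assumes "s \<in> S" "I \<subseteq> S" "x \<in> carrier G" "b \<in> generate G I"
    and add: "len (x \<otimes> b) = len x + len b" and asc: "len x < len (s \<otimes> x)"
    and desc: "len (s \<otimes> (x \<otimes> b)) < len (x \<otimes> b)"
  obtains b' where "b' \<in> generate G I" "s \<otimes> (x \<otimes> b) = x \<otimes> b'" "len b = Suc (len b')"
proof -
  have b: "b \<in> carrier G" using generate_closed[OF assms(2,4)] .
  have s: "{s} \<subseteq> S" "s \<in> generate G {s}" "s \<in> carrier G" using assms(1) by (auto intro: generate.incl)
  have sxb: "s \<otimes> x \<otimes> b = s \<otimes> (x \<otimes> b)" using s b assms by (simp add: m_assoc)
  from reduced_factorisation[OF s(1) assms(2) s(2) assms(3,4)]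
  obtain a' x' b' where f: "a' \<in> generate G {s}" "x' \<in> carrier G" "b' \<in> generate G I"
    "s \<otimes> (x \<otimes> b) = a' \<otimes> x' \<otimes> b'" "len (s \<otimes> (x \<otimes> b)) = len a' + len x' + len b'"
    "len a' < len s \<or> a' = s" "len x' < len x \<or> x' = x" "len b' < len b \<or> b' = b"
    unfolding sxb by metis
  have c: "a' \<in> carrier G" "b' \<in> carrier G"
    using generate_closed[OF s(1) f(1)] generate_closed[OF assms(2) f(3)] .
  have l: "len x + len b = Suc (len (s \<otimes> (x \<otimes> b)))"
    using len_simple_mult[of s "x \<otimes> b"] assms b by auto
  have "a' \<noteq> s"
  proof
    assume "a' = s"
    then have "s \<otimes> (x \<otimes> b) = s \<otimes> (x' \<otimes> b')" using f c s by (simp add: m_assoc)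
    then have "x \<otimes> b = x' \<otimes> b'" using s b f c assms by simp
    then have "len (x \<otimes> b) \<le> len x' + len b'" using len_mult_le f c by simp
    then show False using desc f(5) by simp
  qed
  then have "len a' = 0" using f(6) assms(1) by simp
  then have a': "a' = \<one>" using len_eq_0 c by simp
  then have eq: "s \<otimes> (x \<otimes> b) = x' \<otimes> b'" using f by simp
  have "b' \<noteq> b"
  proof
    assume "b' = b"
    then have "(s \<otimes> x) \<otimes> b = x' \<otimes> b" using eq sxb by simp
    then have "s \<otimes> x = x'" using s b f assms by simp
    then show False using asc f(7) by auto
  qed
  then have "len b' < len b" using f(8) by simp
  then have "x' = x" "len b = Suc (len b')" using l f(5,7) a' by auto
  then show thesis using that f eq by simp
qed

text \<open>
  For \<open>y\<close> the longest element of a finite \<open>W\<^sub>J\<close> this is the familiar formula for the length of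
  \<open>g\<^sup>-\<^sup>1 y\<close>. Write \<open>y = c h\<close> with additive lengths and let \<open>g = s c\<close> be longer than \<open>c\<close>. As \<open>s\<close> is a
  descent of \<open>y\<close> but not of \<open>c\<close>, the exchanged letter comes from \<open>h\<close>.
\<close>

lemma len_quotient_descends_left:
  assumes "J \<subseteq> S" "y \<in> carrier G" "descends_left J y" "g \<in> generate G J"
  shows "len y = len g + len (inv g \<otimes> y)"
  using assms(4)
proof (induction "len g" arbitrary: g)
  case 0
  then have "g = \<one>" using len_eq_0[of g] generate_closed[OF assms(1)] by simp
  then show ?case using assms by simp
next
  case (Suc n)
  have g: "g \<in> carrier G" using generate_closed[OF assms(1) Suc.prems] .
  have "g \<noteq> \<one>" using Suc by auto
  then obtain s c where sc: "s \<in> J" "c \<in> generate G J" "g = s \<otimes> c" "len g = Suc (len c)"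
    using generate_first_letter[OF assms(1) Suc.prems] by blast
  have c: "c \<in> carrier G" "s \<in> S" using generate_closed[OF assms(1) sc(2)] sc(1) assms(1) by auto
  define h where "h = inv c \<otimes> y"
  have h: "h \<in> carrier G" "y = c \<otimes> h" using c assms(2) by (auto simp: h_def)
  have "len y = len c + len (inv c \<otimes> y)"
    by (rule Suc.hyps(1)) (use Suc.hyps(2) sc in auto)
  then have IH: "len (c \<otimes> h) = len c + len h" unfolding h(2)[symmetric] unfolding h_def .
  have hS: "h \<in> generate G S" using h S_generates by simp
  have up: "len c < len (s \<otimes> c)" using sc by simp
  have down: "len (s \<otimes> (c \<otimes> h)) < len (c \<otimes> h)"
    using assms(3) sc(1) unfolding h(2)[symmetric] descends_left_def by blast
  obtain h' where h': "h' \<in> generate G S" "s \<otimes> (c \<otimes> h) = c \<otimes> h'" "len h = Suc (len h')"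
    using exchange_left[OF c(2) subset_refl c(1) hS IH up down] .
  have "inv g \<otimes> y = inv c \<otimes> (s \<otimes> (c \<otimes> h))"
    unfolding h(2)[symmetric] using sc(3) c assms(2) by (simp add: inv_mult_group m_assoc)
  also have "\<dots> = h'" using h' c S_generates by simp
  finally have q: "inv g \<otimes> y = h'" .
  have "len y = len c + len h" using IH unfolding h(2)[symmetric] .
  then show ?case unfolding q using h'(3) sc(4) by simp
qed

text \<open>
  Each of \<open>y\<close> and \<open>a y\<close> is longer than the other by the length of \<open>a\<close>.
\<close>

lemma descends_left_unique:
  assumes "J \<subseteq> S" "y \<in> carrier G" "a \<in> generate G J"
    and "descends_left J y" "descends_left J (a \<otimes> y)"
  shows "a = \<one>"
proof -
  have a: "a \<in> carrier G" using generate_closed[OF assms(1,3)] .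
  have "len y = len a + len (a \<otimes> y)"
    using len_quotient_descends_left[OF assms(1,2,4) generate_inv[OF assms(1,3)]] a by simp
  moreover have "len (a \<otimes> y) = len a + len y"
    using len_quotient_descends_left[OF assms(1) _ assms(5,3)] a assms(2) by simp
  ultimately have "len a = 0" by simp
  then show ?thesis using len_eq_0 a by simp
qed

lemma descends_right_unique:
  assumes "I \<subseteq> S" "y \<in> carrier G" "b \<in> generate G I"
    and "descends_right I y" "descends_right I (y \<otimes> b)"
  shows "b = \<one>"
proof -
  have b: "b \<in> carrier G" using generate_closed[OF assms(1,3)] .
  have "inv b = \<one>"
  proof (rule descends_left_unique[OF assms(1)])
    show "descends_left I (inv y)" using assms descends_right_inv by simp
    show "descends_left I (inv b \<otimes> inv y)"
      using assms b descends_right_inv[of I "y \<otimes> b"] by (simp add: inv_mult_group)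
  qed (use assms generate_inv in auto)
  then show ?thesis using b by (metis inv_inv inv_one)
qed

text \<open>
  Split \<open>y = v b\<close> with \<open>v\<close> minimal in the coset \<open>y W\<^sub>I\<close>. Having no right descent in \<open>I\<close>, the factor
  \<open>v\<close> lies in \<open>W\<^sub>J d\<close>, and the descents of \<open>y\<close> in \<open>I\<close> are those of \<open>b\<close>.
\<close>

lemma descends_right_factorisation:
  assumes "J \<subseteq> S" "I \<subseteq> S" "d \<in> carrier G" "ascends_left J d" "ascends_right I d"
    and "y \<in> dcos J d I" "descends_right I y"
  obtains a b where "a \<in> generate G J" "b \<in> generate G I" "y = a \<otimes> d \<otimes> b" "descends_right I b"
proof -
  have e: "{} \<subseteq> S" by simp
  have y: "y \<in> carrier G" using dcos_closed[OF assms(1-3,6)] .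
  define v where "v = min_elt G S (dcos {} y I)"
  have yI: "dcos {} y I \<in> double_cosets G {} I" unfolding double_cosets_iff using y by blast
  have v: "v \<in> carrier G" "v \<in> dcos {} y I" "dcos {} y I = dcos {} v I" "ascends_right I v"
    unfolding v_def using min_elt_double_coset[OF e assms(2) yI] by auto
  have "y \<in> dcos {} v I" unfolding v(3)[symmetric] by (rule dcos_self[OF y])
  then obtain b where b: "b \<in> generate G I" "y = v \<otimes> b"
    unfolding mem_dcos using v(1) by (auto simp: generate_empty)
  have bc: "b \<in> carrier G" using generate_closed[OF assms(2) b(1)] .
  have "v \<in> dcos J d I"
    using dcos_subset[OF assms(1,2) empty_subsetI subset_refl assms(3,6)] v(2) by blast
  then obtain a b' where f: "a \<in> generate G J" "b' \<in> generate G I"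
    "v = a \<otimes> d \<otimes> b'" "len v = len a + len d + len b'"
    by (rule ascending_factorisation[OF assms(1-5)])
  have c: "a \<in> carrier G" "b' \<in> carrier G"
    using generate_closed[OF assms(1) f(1)] generate_closed[OF assms(2) f(2)] .
  have "b' = \<one>"
  proof (rule ascending_right_factor[OF assms(2) f(2), of "a \<otimes> d"])
    show "len (a \<otimes> d \<otimes> b') = len (a \<otimes> d) + len b'"
      using f c len_mult_le[of a d] len_mult_le[of "a \<otimes> d" b'] assms(3) by simp
  qed (use f c v assms(3) in auto)
  then have "v = a \<otimes> d" using f c assms(3) by simp
  moreover have "descends_right I b" unfolding descends_right_def
  proof
    fix s assume s: "s \<in> I"
    have "len (v \<otimes> (b \<otimes> s)) < len (v \<otimes> b)"
      using assms(2,7) s b bc v(1) by (auto simp: descends_right_def m_assoc subset_iff)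
    then show "len (b \<otimes> s) < len b"
      using len_mult_ascends_right[OF assms(2) v(1,4)] b generate_mult[OF b(1) generate.incl[OF s]]
      by simp
  qed
  ultimately show thesis using that f b by blast
qed

text \<open>
  The right factor \<open>b\<close> has all descents in \<open>I\<close> and is therefore the same for \<open>y\<close> and \<open>z\<close>. So the
  maximum of a double coset can be compared with elements that are extremal only on the right.
\<close>

lemma descends_right_same_coset:
  assumes "J \<subseteq> S" "I \<subseteq> S" "d \<in> carrier G" "ascends_left J d" "ascends_right I d"
    and "y \<in> dcos J d I" "descends_right I y" "z \<in> dcos J d I" "descends_right I z"
  obtains a where "a \<in> generate G J" "z = a \<otimes> y"
proof -
  obtain a b where ab: "a \<in> generate G J" "b \<in> generate G I" "y = a \<otimes> d \<otimes> b" "descends_right I b"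
    by (rule descends_right_factorisation[OF assms(1-7)])
  obtain a' b' where ab': "a' \<in> generate G J" "b' \<in> generate G I" "z = a' \<otimes> d \<otimes> b'" "descends_right I b'"
    by (rule descends_right_factorisation[OF assms(1-5,8,9)])
  have c: "a \<in> carrier G" "b \<in> carrier G" "a' \<in> carrier G" "b' \<in> carrier G"
    using generate_closed[OF assms(1)] generate_closed[OF assms(2)] ab ab' by auto
  have "inv b \<otimes> b' = \<one>"
    by (rule descends_right_unique[OF assms(2) c(2)])
      (use c ab ab' generate_mult generate_inv[OF assms(2)] in auto)
  then have "b' = b" using c by (metis inv_cancel_left(2) r_one)
  then have "z = (a' \<otimes> inv a) \<otimes> y" using ab ab' c assms(3) by (simp add: m_assoc)
  then show thesis using that generate_mult[OF ab'(1) generate_inv[OF assms(1) ab(1)]] by blast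
qed

lemma bruhat_maximal_descends:
  assumes "J \<subseteq> S" "I \<subseteq> S" "p \<in> double_cosets G J I" "x \<in> p"
    and max: "\<forall>y\<in>p. bruhat_le G S x y \<longrightarrow> y = x"
  shows "descends_left J x" "descends_right I x"
proof -
  have x: "x \<in> carrier G" using double_coset_eq(1)[OF assms(1-4)] .
  show "descends_left J x" unfolding descends_left_def
  proof
    fix s assume s: "s \<in> J"
    then have sS: "s \<in> S" using assms by auto
    have "\<not> len x < len (s \<otimes> x)"
      using max dcos_step(1)[OF assms(1-4) s] bruhat_le_left[OF sS x] by fastforce
    then show "len (s \<otimes> x) < len x" using len_simple_mult_neq[OF sS x] by simp
  qed
  show "descends_right I x" unfolding descends_right_def
  proof
    fix s assume s: "s \<in> I"
    then have sS: "s \<in> S" using assms by auto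
    have "\<not> len x < len (x \<otimes> s)"
      using max dcos_step(2)[OF assms(1-4) s] bruhat_le_right[OF sS x] by fastforce
    then show "len (x \<otimes> s) < len x" using len_mult_simple_neq[OF sS x] by simp
  qed
qed

text \<open>
  A longest element exists because \<open>p\<close> is finite, and it is Bruhat-maximal. Conversely every
  Bruhat-maximal element has all descents on both sides: those on the right place it in one coset
  of \<open>W\<^sub>J\<close>, and those on the left determine it there.
\<close>

lemma max_elt_double_coset:
  assumes "J \<subseteq> S" "I \<subseteq> S" "p \<in> double_cosets G J I" "finite p"
  shows "max_elt G S p \<in> p" "descends_right I (max_elt G S p)"
    "u \<in> p \<Longrightarrow> len u \<le> len (max_elt G S p)"
proof -
  define d where "d = min_elt G S p"
  have d: "d \<in> carrier G" "d \<in> p" "p = dcos J d I" "ascends_left J d" "ascends_right I d"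
    unfolding d_def using min_elt_double_coset[OF assms(1-3)] by auto
  have "finite (len ` p)" "len ` p \<noteq> {}" using assms(4) d(2) by auto
  then have "Max (len ` p) \<in> len ` p" "\<forall>u\<in>p. len u \<le> Max (len ` p)" by auto
  then obtain y where y: "y \<in> p" "\<And>u. u \<in> p \<Longrightarrow> len u \<le> len y"
    by auto
  have ymax: "\<forall>z\<in>p. bruhat_le G S y z \<longrightarrow> z = y" using y(2) bruhat_le_len by fastforce
  have desc: "descends_left J y" "descends_right I y"
    using bruhat_maximal_descends[OF assms(1-3) y(1) ymax] .
  have "max_elt G S p = y" unfolding max_elt_def
  proof (rule the_equality)
    show "y \<in> p \<and> (\<forall>z\<in>p. bruhat_le G S y z \<longrightarrow> z = y)" using y(1) ymax by blast
    fix x assume x: "x \<in> p \<and> (\<forall>z\<in>p. bruhat_le G S x z \<longrightarrow> z = x)"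
    then have xdesc: "descends_left J x" "descends_right I x"
      using bruhat_maximal_descends[OF assms(1-3)] by blast+
    have xy: "y \<in> dcos J d I" "x \<in> dcos J d I" using x y(1) d(3) by simp_all
    obtain a where a: "a \<in> generate G J" "x = a \<otimes> y"
      by (rule descends_right_same_coset[OF assms(1,2) d(1,4,5) xy(1) desc(2) xy(2) xdesc(2)])
    have yc: "y \<in> carrier G" using dcos_closed[OF assms(1,2) d(1) xy(1)] .
    have "a = \<one>" using descends_left_unique[OF assms(1) yc a(1) desc(1)] xdesc(1) a(2) by simp
    then show "x = y" using a yc by simp
  qed
  then show "max_elt G S p \<in> p" "descends_right I (max_elt G S p)"
    "u \<in> p \<Longrightarrow> len u \<le> len (max_elt G S p)"
    using y desc by auto
qed

section \<open>Redundancy\<close>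

text \<open>
  This is \<open>J \<inter> d I d\<^sup>-\<^sup>1\<close>. It depends on an element rather than on a double coset, so it can be
  compared for different \<open>J\<close> and the same \<open>d\<close>.
\<close>

definition redundancy :: "'a set \<Rightarrow> 'a \<Rightarrow> 'a set \<Rightarrow> 'a set" where
  "redundancy J d I = {s \<in> J. \<exists>r\<in>I. s \<otimes> d = d \<otimes> r}"

lemma conj_eq_iff:
  assumes "d \<in> carrier G" "s \<in> carrier G" "r \<in> carrier G"
  shows "s = d \<otimes> r \<otimes> inv d \<longleftrightarrow> s \<otimes> d = d \<otimes> r"
proof
  assume "s = d \<otimes> r \<otimes> inv d"
  then show "s \<otimes> d = d \<otimes> r" using assms by (simp add: m_assoc)
next
  assume "s \<otimes> d = d \<otimes> r"
  then have "d \<otimes> r \<otimes> inv d = s \<otimes> d \<otimes> inv d" by simp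
  then show "s = d \<otimes> r \<otimes> inv d" using assms by (simp add: m_assoc)
qed

lemma left_redundancy_eq:
  assumes "J \<subseteq> S" "I \<subseteq> S" "p \<in> double_cosets G J I"
  shows "left_redundancy G S J I p = redundancy J (min_elt G S p) I"
proof -
  have d: "min_elt G S p \<in> carrier G" using min_elt_double_coset[OF assms] by blast
  have "s = min_elt G S p \<otimes> r \<otimes> inv (min_elt G S p) \<longleftrightarrow> s \<otimes> min_elt G S p = min_elt G S p \<otimes> r"
    if "s \<in> J" "r \<in> I" for s r
    by (rule conj_eq_iff[OF d]) (use that assms in auto)
  then show ?thesis
    unfolding left_redundancy_def redundancy_def l_coset_def r_coset_def by auto
qed

lemma right_redundancy_eq:
  assumes "J \<subseteq> S" "I \<subseteq> S" "p \<in> double_cosets G J I"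
  shows "right_redundancy G S J I p = {r \<in> I. \<exists>s\<in>J. s \<otimes> min_elt G S p = min_elt G S p \<otimes> r}"
proof -
  define d where "d = min_elt G S p"
  have d: "d \<in> carrier G" using min_elt_double_coset[OF assms] unfolding d_def by blast
  have "r = inv d \<otimes> s \<otimes> d \<longleftrightarrow> s \<otimes> d = d \<otimes> r"
    if "s \<in> J" "r \<in> I" for s r
  proof -
    have "s \<in> carrier G" "r \<in> carrier G" using that assms by auto
    then show ?thesis using d by (auto simp: m_assoc)
  qed
  then show ?thesis
    unfolding right_redundancy_def d_def[symmetric] l_coset_def r_coset_def by auto
qed

text \<open>
  Redundant letters can be moved across \<open>d\<close>, so \<open>W\<^sub>K d\<close> is contained in \<open>d W\<^sub>N\<close>.
\<close>

lemma redundancy_coset: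
  assumes "K \<subseteq> S" "N \<subseteq> S" "d \<in> carrier G" "K \<subseteq> redundancy J d N" "a \<in> generate G K"
  shows "\<exists>b\<in>generate G N. a \<otimes> d = d \<otimes> b"
  using assms(5)
proof induction
  case one
  show ?case using assms(3) by (intro bexI[of _ \<one>]) (auto intro: generate.one)
next
  case (incl h)
  then show ?case using assms(4) by (auto simp: redundancy_def intro: generate.incl)
next
  case (inv h)
  moreover have "inv h = h" using inv assms(1) by auto
  ultimately show ?case using assms(4) by (auto simp: redundancy_def intro: generate.incl)
next
  case (eng a1 a2)
  then obtain b1 b2 where b: "b1 \<in> generate G N" "a1 \<otimes> d = d \<otimes> b1"
    "b2 \<in> generate G N" "a2 \<otimes> d = d \<otimes> b2" by blast
  have c: "a1 \<in> carrier G" "a2 \<in> carrier G" "b1 \<in> carrier G" "b2 \<in> carrier G"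
    using generate_closed[OF assms(1)] generate_closed[OF assms(2)] eng b by auto
  have "a1 \<otimes> a2 \<otimes> d = a1 \<otimes> (d \<otimes> b2)" using c assms(3) b(4) by (simp add: m_assoc)
  also have "\<dots> = (a1 \<otimes> d) \<otimes> b2" using c assms(3) by (simp add: m_assoc)
  also have "\<dots> = d \<otimes> (b1 \<otimes> b2)" using c assms(3) b(2) by (simp add: m_assoc)
  finally show ?case using generate_mult[OF b(1,3)] by blast
qed

text \<open>
  Comparing lengths in \<open>s d = d g\<close> gives \<open>g\<close> length 1.
\<close>

lemma ascending_conjugate_simple:
  assumes "s \<in> S" "N \<subseteq> S" "d \<in> carrier G" "len d < len (s \<otimes> d)" "ascends_right N d"
    and "g \<in> generate G N" "s \<otimes> d = d \<otimes> g"
  shows "g \<in> N"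
proof -
  have "len (s \<otimes> d) = Suc (len d)" using len_simple_mult[OF assms(1,3)] assms(4) by auto
  moreover have "len (d \<otimes> g) = len d + len g" using len_mult_ascends_right[OF assms(2,3,5,6)] .
  ultimately have "len g = 1" using assms(7) by simp
  then show ?thesis using generate_len_1[OF assms(2,6)] by blast
qed

text \<open>
  The heart of the proof: one descending step, read backwards. Let \<open>d\<close> and \<open>e\<close> be the minimal
  elements of \<open>q\<close> and \<open>q'\<close>, and \<open>y\<close> the maximum of \<open>q\<close>. As \<open>K\<close> is redundant for \<open>e\<close>, the coset \<open>q'\<close>
  is \<open>e W\<close> with \<open>W = generate G N'\<close>, so \<open>y = e b\<close>; and \<open>e = d c\<close> with additive lengths,
  so \<open>d\<close> inherits the absence of left descents from \<open>e\<close>.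

  Redundancy with respect to \<open>e\<close> passes to \<open>d\<close> by conjugating with \<open>c\<close>. For the converse let \<open>s\<close> be in \<open>J\<close> with
  \<open>s d = d r\<close>. Then \<open>s y\<close> is again in \<open>q\<close>, hence shorter than \<open>y = e b\<close>. As \<open>s\<close> is not a
  left descent of \<open>e\<close>, the exchanged letter lies in \<open>b\<close>, which says that \<open>s e\<close> is in \<open>e W\<close>.
\<close>

lemma redundancy_down_step:
  assumes sub: "J \<subseteq> S" "N \<subseteq> S" "N' \<subseteq> N" "K \<subseteq> J"
    and q: "q \<in> double_cosets G K N" "finite q"
    and q': "q' = dcos K (max_elt G S q) N'"
    and asc': "ascends_left J (min_elt G S q')"
    and red': "redundancy J (min_elt G S q') N' = K"
  shows "ascends_left J (min_elt G S q) \<and> redundancy J (min_elt G S q) N = K"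
proof -
  have KS: "K \<subseteq> S" and N'S: "N' \<subseteq> S" using sub by auto
  define d where "d = min_elt G S q"
  define e where "e = min_elt G S q'"
  define y where "y = max_elt G S q"
  have d: "d \<in> carrier G" "q = dcos K d N" "ascends_left K d" "ascends_right N d"
    unfolding d_def using min_elt_double_coset[OF KS sub(2) q(1)] by auto
  have y: "y \<in> q" "\<And>u. u \<in> q \<Longrightarrow> len u \<le> len y"
    unfolding y_def using max_elt_double_coset[OF KS sub(2) q] by auto
  have yc: "y \<in> carrier G" using double_coset_eq(1)[OF KS sub(2) q(1) y(1)] .
  have q'dc: "q' \<in> double_cosets G K N'" unfolding double_cosets_iff using q' yc y_def by blast
  have e: "e \<in> carrier G" "e \<in> q'" "q' = dcos K e N'" "ascends_right N' e"
    unfolding e_def using min_elt_double_coset[OF KS N'S q'dc] by auto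
  have ascJ: "ascends_left J e" and redJ: "redundancy J e N' = K"
    unfolding e_def using asc' red' .
  have ascK: "ascends_left K e" using ascJ sub(4) by (auto simp: ascends_left_def)
  \<comment> \<open>\<open>q'\<close> is a single coset: the left factor of \<open>y\<close> can be moved across \<open>e\<close>.\<close>
  have "y \<in> q'" unfolding q' y_def[symmetric] by (rule dcos_self[OF yc])
  then obtain a b0 where ab0: "a \<in> generate G K" "b0 \<in> generate G N'" "y = a \<otimes> e \<otimes> b0"
    unfolding e(3) mem_dcos by blast
  obtain b1 where b1: "b1 \<in> generate G N'" "a \<otimes> e = e \<otimes> b1"
    using redundancy_coset[OF KS N'S e(1) _ ab0(1), of J] redJ by blast
  define b where "b = b1 \<otimes> b0"
  have b: "b \<in> generate G N'" "b \<in> carrier G" "y = e \<otimes> b"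
  proof -
    show bN: "b \<in> generate G N'" unfolding b_def using generate_mult[OF b1(1) ab0(2)] .
    then show "b \<in> carrier G" using generate_closed[OF N'S] by blast
    show "y = e \<otimes> b" unfolding b_def
      using ab0(3) b1(2) generate_closed[OF N'S b1(1)] generate_closed[OF N'S ab0(2)] e(1)
      by (simp add: m_assoc)
  qed
  \<comment> \<open>As \<open>e\<close> has no left descent in \<open>K\<close>, its factorisation through \<open>d\<close> has trivial left factor.\<close>
  have "y \<in> dcos K d N" using y(1) d(2) by blast
  then have "dcos K y N' \<subseteq> dcos K d N"
    by (rule dcos_subset[OF KS sub(2) subset_refl sub(3) d(1)])
  then have "e \<in> dcos K d N" using e(2) q' y_def by blast
  then obtain a' c where ac: "a' \<in> generate G K" "c \<in> generate G N"
    "e = a' \<otimes> d \<otimes> c" "len e = len a' + len d + len c"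
    by (rule ascending_factorisation[OF KS sub(2) d(1,3,4)])
  have cc: "a' \<in> carrier G" "c \<in> carrier G"
    using generate_closed[OF KS ac(1)] generate_closed[OF sub(2) ac(2)] .
  have "a' = \<one>"
  proof (rule ascending_left_factor[OF KS ac(1), of "d \<otimes> c"])
    show "ascends_left K (a' \<otimes> (d \<otimes> c))" using ascK ac(3) cc d(1) by (simp add: m_assoc)
    show "len (a' \<otimes> (d \<otimes> c)) = len a' + len (d \<otimes> c)"
      using ac cc d(1) len_mult_le[of d c] len_mult_le[of a' "d \<otimes> c"] by (simp add: m_assoc)
  qed (use cc d(1) in simp)
  then have edc: "e = d \<otimes> c" "len e = len d + len c" using ac cc d(1) by auto
  have ascd: "ascends_left J d" unfolding ascends_left_def
  proof
    fix s assume s: "s \<in> J"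
    then have sS: "s \<in> S" using sub(1) by auto
    have "len (s \<otimes> e) \<le> len (s \<otimes> d) + len c"
      using len_mult_le[of "s \<otimes> d" c] sS cc d(1) edc(1) by (simp add: m_assoc)
    moreover have "len e < len (s \<otimes> e)" using ascJ s by (auto simp: ascends_left_def)
    ultimately show "len d < len (s \<otimes> d)" using edc(2) by simp
  qed
  have "s \<in> K \<longleftrightarrow> s \<in> redundancy J d N" for s
  proof
    assume sK: "s \<in> K"
    then have s: "s \<in> J" "s \<in> S" using sub by auto
    obtain r where r: "r \<in> N'" "s \<otimes> e = e \<otimes> r"
      using sK redJ unfolding redundancy_def by blast
    define g where "g = c \<otimes> r \<otimes> inv c"
    have rc: "r \<in> carrier G" using r N'S by auto
    have rN: "r \<in> generate G N" using r(1) sub(3) by (auto intro: generate.incl)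
    have g: "g \<in> generate G N"
      unfolding g_def using ac(2) rN by (intro generate_mult generate_inv[OF sub(2)])
    have "s \<otimes> d = s \<otimes> e \<otimes> inv c" using edc(1) cc d(1) s by (simp add: m_assoc)
    also have "\<dots> = d \<otimes> g" using r(2) edc(1) rc cc d(1) by (simp add: g_def m_assoc)
    finally have sd: "s \<otimes> d = d \<otimes> g" .
    have "len d < len (s \<otimes> d)" using ascd s by (auto simp: ascends_left_def)
    then have "g \<in> N" using ascending_conjugate_simple[OF s(2) sub(2) d(1) _ d(4) g sd] by blast
    then show "s \<in> redundancy J d N" using s sd by (auto simp: redundancy_def)
  next
    assume "s \<in> redundancy J d N"
    then obtain r where s: "s \<in> J" and r: "r \<in> N" "s \<otimes> d = d \<otimes> r"
      by (auto simp: redundancy_def)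
    have sS: "s \<in> S" using s sub by auto
    have rc: "r \<in> carrier G" using r(1) sub(2) by auto
    have bN: "b \<in> generate G N" using b(1) mono_generate[OF sub(3)] by blast
    have "s \<otimes> y = s \<otimes> d \<otimes> c \<otimes> b" using b edc(1) cc d(1) sS by (simp add: m_assoc)
    also have "\<dots> = \<one> \<otimes> d \<otimes> (r \<otimes> c \<otimes> b)" using r(2) rc b(2) cc d(1) by (simp add: m_assoc)
    finally have "s \<otimes> y \<in> dcos K d N"
      unfolding mem_dcos using generate_mult[OF generate_mult[OF generate.incl[OF r(1)] ac(2)] bN] generate.one by blast
    then have "len (s \<otimes> y) \<le> len y" using y(2) d(2) by blast
    then have down: "len (s \<otimes> (e \<otimes> b)) < len (e \<otimes> b)"
      using len_simple_mult_neq[OF sS yc] b(3) by simp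
    have up: "len e < len (s \<otimes> e)" using ascJ s by (auto simp: ascends_left_def)
    obtain b' where b': "b' \<in> generate G N'" "s \<otimes> (e \<otimes> b) = e \<otimes> b'"
      using exchange_left[OF sS N'S e(1) b(1) len_mult_ascends_right[OF N'S e(1,4) b(1)] up down] .
    have b'c: "b' \<in> carrier G" using generate_closed[OF N'S b'(1)] .
    define g where "g = b' \<otimes> inv b"
    have g: "g \<in> generate G N'"
      unfolding g_def using b'(1) b(1) by (intro generate_mult generate_inv[OF N'S])
    have "s \<otimes> e = s \<otimes> (e \<otimes> b) \<otimes> inv b" using sS e(1) b(2) by (simp add: m_assoc)
    also have "\<dots> = e \<otimes> g" unfolding b'(2) g_def using e(1) b'c b(2) by (simp add: m_assoc)
    finally have se: "s \<otimes> e = e \<otimes> g" .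
    have "g \<in> N'" using ascending_conjugate_simple[OF sS N'S e(1) up e(4) g se] .
    then show "s \<in> K" using s se redJ by (auto simp: redundancy_def)
  qed
  then show ?thesis using ascd unfolding d_def by blast
qed

section \<open>Forward paths\<close>

lemma expression_subset:
  assumes "is_expression G S Is" "i < length Is"
  shows "Is ! i \<subseteq> S" "finite (generate G (Is ! i))"
  using assms by (auto simp: is_expression_def finitary_def)

lemma expression_start: "is_expression G S Is \<Longrightarrow> Is ! 0 \<subseteq> S \<and> finite (generate G (Is ! 0))"
  using expression_subset[of Is 0] by (auto simp: is_expression_def)

lemma expression_step:
  assumes "is_expression G S Is" "Suc i < length Is"
  shows "Is ! i \<subset> Is ! Suc i \<or> Is ! Suc i \<subseteq> Is ! i"
  using assms unfolding is_expression_def by blast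

lemma forward_path_0:
  assumes "is_expression G S Is"
  shows "forward_path G S Is 0 = dcos (Is ! 0) \<one> (Is ! 0)"
  using the_double_coset[of "Is ! 0" "Is ! 0" \<one>] expression_start[OF assms] by simp

lemma forward_path_up:
  assumes "is_expression G S Is" "Suc i < length Is" "Is ! i \<subset> Is ! Suc i"
    and "forward_path G S Is i = dcos (Is ! 0) x (Is ! i)" "x \<in> carrier G"
  shows "forward_path G S Is (Suc i) = dcos (Is ! 0) x (Is ! Suc i)"
proof -
  have S: "Is ! 0 \<subseteq> S" "Is ! Suc i \<subseteq> S"
    using expression_start[OF assms(1)] expression_subset[OF assms(1,2)] by auto
  have "(THE q. q \<in> double_cosets G (Is ! 0) (Is ! Suc i) \<and> dcos (Is ! 0) x (Is ! i) \<subseteq> q)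
    = dcos (Is ! 0) x (Is ! Suc i)"
  proof (rule the_equality)
    have "dcos (Is ! 0) x (Is ! i) \<subseteq> dcos (Is ! 0) x (Is ! Suc i)"
      using S assms(3) by (intro dcos_subset dcos_self assms(5)) auto
    then show "dcos (Is ! 0) x (Is ! Suc i) \<in> double_cosets G (Is ! 0) (Is ! Suc i) \<and>
      dcos (Is ! 0) x (Is ! i) \<subseteq> dcos (Is ! 0) x (Is ! Suc i)"
      unfolding double_cosets_iff using assms(5) by blast
  next
    fix q assume q: "q \<in> double_cosets G (Is ! 0) (Is ! Suc i) \<and> dcos (Is ! 0) x (Is ! i) \<subseteq> q"
    then have "x \<in> q" using dcos_self[OF assms(5)] by blast
    then show "q = dcos (Is ! 0) x (Is ! Suc i)" using double_coset_eq(2)[OF S] q by blast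
  qed
  then show ?thesis using assms(3,4) by simp
qed

lemma forward_path_down:
  assumes "is_expression G S Is" "Suc i < length Is" "\<not> Is ! i \<subset> Is ! Suc i"
    and "forward_path G S Is i \<in> double_cosets G (Is ! 0) (Is ! i)"
  shows "forward_path G S Is (Suc i) =
    dcos (Is ! 0) (max_elt G S (forward_path G S Is i)) (Is ! Suc i)"
    and "max_elt G S (forward_path G S Is i) \<in> carrier G"
    and "finite (forward_path G S Is i)"
proof -
  have S: "Is ! 0 \<subseteq> S" "Is ! Suc i \<subseteq> S" "Is ! i \<subseteq> S" and
    fin: "finite (generate G (Is ! 0))" "finite (generate G (Is ! i))"
    using expression_start[OF assms(1)] expression_subset[OF assms(1)] assms(2) by auto
  show f: "finite (forward_path G S Is i)"
    using assms(4) finite_dcos[OF fin] unfolding double_cosets_iff by auto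
  have "max_elt G S (forward_path G S Is i) \<in> forward_path G S Is i"
    using max_elt_double_coset(1)[OF S(1,3) assms(4) f] .
  then show c: "max_elt G S (forward_path G S Is i) \<in> carrier G"
    by (rule double_coset_eq(1)[OF S(1,3) assms(4)])
  show "forward_path G S Is (Suc i) =
    dcos (Is ! 0) (max_elt G S (forward_path G S Is i)) (Is ! Suc i)"
    using the_double_coset[OF S(1,2) c] assms(3) by simp
qed

\<comment> \<open>From here on the lemmas above replace the definite descriptions in the recursion equations.\<close>
declare forward_path.simps [simp del]

lemma forward_path_double_coset:
  assumes "is_expression G S Is" "i < length Is"
  shows "forward_path G S Is i \<in> double_cosets G (Is ! 0) (Is ! i)"
  using assms(2)
proof (induction i)
  case 0
  show ?case unfolding forward_path_0[OF assms(1)] double_cosets_iff by blast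
next
  case (Suc i)
  then have IH: "forward_path G S Is i \<in> double_cosets G (Is ! 0) (Is ! i)" by simp
  show ?case
  proof (cases "Is ! i \<subset> Is ! Suc i")
    case True
    from IH obtain x where x: "x \<in> carrier G" "forward_path G S Is i = dcos (Is ! 0) x (Is ! i)"
      unfolding double_cosets_iff by blast
    show ?thesis unfolding forward_path_up[OF assms(1) Suc.prems True x(2,1)] double_cosets_iff
      using x(1) by blast
  next
    case False
    show ?thesis
      unfolding forward_path_down(1)[OF assms(1) Suc.prems False IH] double_cosets_iff
      using forward_path_down(2)[OF assms(1) Suc.prems False IH] by blast
  qed
qed

lemma forward_path_min:
  assumes "is_expression G S Is" "i < length Is"
  defines "d \<equiv> min_elt G S (forward_path G S Is i)"
  shows "d \<in> carrier G" "forward_path G S Is i = dcos (Is ! 0) d (Is ! i)"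
    "ascends_left (Is ! 0) d" "ascends_right (Is ! i) d"
  unfolding d_def
  using min_elt_double_coset[OF _ _ forward_path_double_coset[OF assms(1,2)]]
    expression_start[OF assms(1)] expression_subset[OF assms(1,2)] by auto

text \<open>
  If at the end of a reduced path the minimal element has no left descent in \<open>J\<close> and redundancy in
  \<open>J\<close> equal to the starting set, the same holds everywhere on the path. The induction runs backwards: ascending steps
  use reducedness, descending steps use \<open>redundancy_down_step\<close>.
\<close>

lemma reduced_path_invariant:
  assumes M: "is_expression G S M" "reduced G S M"
    and J: "J \<subseteq> S" "M ! 0 \<subseteq> J"
    and last: "ascends_left J (min_elt G S (forward_path G S M m))"
      "redundancy J (min_elt G S (forward_path G S M m)) (M ! m) = M ! 0"
    and m: "m < length M" and i: "i \<le> m"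
  shows "ascends_left J (min_elt G S (forward_path G S M i)) \<and>
    redundancy J (min_elt G S (forward_path G S M i)) (M ! i) = M ! 0"
  using i
proof (induction rule: inc_induct)
  case base
  show ?case using last by blast
next
  case (step i)
  have i: "Suc i < length M" "i < length M" using step m by auto
  let ?d = "min_elt G S (forward_path G S M i)" and ?e = "min_elt G S (forward_path G S M (Suc i))"
  have S: "M ! 0 \<subseteq> S" "M ! i \<subseteq> S" "M ! Suc i \<subseteq> S"
    using expression_start[OF M(1)] expression_subset[OF M(1)] i by auto
  note dc = forward_path_double_coset[OF M(1) i(2)] forward_path_double_coset[OF M(1) i(1)]
  show ?case
  proof (cases "M ! i \<subset> M ! Suc i")
    case True
    then have eq: "?d = ?e" and red: "redundancy (M ! 0) ?d (M ! i) = redundancy (M ! 0) ?e (M ! Suc i)"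
      using M(2) i left_redundancy_eq[OF S(1,2) dc(1)] left_redundancy_eq[OF S(1,3) dc(2)]
      unfolding reduced_def by simp_all
    have "redundancy J ?d (M ! i) \<subseteq> redundancy J ?e (M ! Suc i)"
      using True eq by (auto simp: redundancy_def)
    moreover have "M ! 0 \<subseteq> redundancy (M ! 0) ?e (M ! Suc i)"
      using step.IH unfolding redundancy_def by blast
    moreover have "redundancy (M ! 0) ?d (M ! i) \<subseteq> redundancy J ?d (M ! i)"
      using J(2) by (auto simp: redundancy_def)
    ultimately show ?thesis using step.IH red eq by auto
  next
    case False
    then have down: "M ! Suc i \<subseteq> M ! i" using expression_step[OF M(1) i(1)] by blast
    show ?thesis
      using redundancy_down_step[OF J(1) S(2) down J(2) dc(1)
        forward_path_down(3,1)[OF M(1) i(1) False dc(1)]] step.IH by blast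
  qed
qed

text \<open>
  The path of \<open>M\<close>, started from a larger set \<open>J = C ! 0\<close>, consists of the double cosets of the
  same minimal elements. At a descending step the two paths continue from the maxima \<open>y\<close> and \<open>z\<close>
  of different double cosets, but \<open>z\<close> lies in \<open>W\<^sub>J y\<close>.
\<close>

lemma forward_path_suffix:
  assumes M: "is_expression G S M" "reduced G S M"
    and C: "is_expression G S C" "a + m < length C" "\<And>i. i \<le> m \<Longrightarrow> C ! (a + i) = M ! i"
    and start: "forward_path G S C a = dcos (C ! 0) \<one> (M ! 0)" "M ! 0 \<subseteq> C ! 0"
    and asc: "\<And>i. i \<le> m \<Longrightarrow> ascends_left (C ! 0) (min_elt G S (forward_path G S M i))"
    and m: "m < length M" and i: "i \<le> m"
  shows "forward_path G S C (a + i) = dcos (C ! 0) (min_elt G S (forward_path G S M i)) (M ! i)"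
  using i
proof (induction i)
  case 0
  have S: "M ! 0 \<subseteq> S" using expression_start[OF M(1)] by blast
  have "len \<one> < len (\<one> \<otimes> s)" "len \<one> < len (s \<otimes> \<one>)" if "s \<in> M ! 0" for s
  proof -
    have "s \<in> S" using that S by blast
    then show "len \<one> < len (\<one> \<otimes> s)" "len \<one> < len (s \<otimes> \<one>)" by simp_all
  qed
  then have "min_elt G S (dcos (M ! 0) \<one> (M ! 0)) = \<one>"
    using S by (intro min_elt_dcos) (auto simp: ascends_left_def ascends_right_def simp del: len_one)
  then show ?case using start forward_path_0[OF M(1)] by simp
next
  case (Suc i)
  have im: "i \<le> m" "Suc i < length M" "i < length M" "Suc (a + i) < length C"
    using Suc.prems m C(2) by auto
  have IH: "forward_path G S C (a + i) = dcos (C ! 0) (min_elt G S (forward_path G S M i)) (M ! i)"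
    using Suc.IH im by blast
  have Ci: "C ! (a + i) = M ! i" "C ! Suc (a + i) = M ! Suc i"
    using C(3)[of i] C(3)[of "Suc i"] Suc.prems by auto
  have S: "C ! 0 \<subseteq> S" "M ! 0 \<subseteq> S" "M ! i \<subseteq> S" "M ! Suc i \<subseteq> S"
    using expression_start[OF C(1)] expression_start[OF M(1)] expression_subset[OF M(1)] im by auto
  let ?d = "min_elt G S (forward_path G S M i)" and ?e = "min_elt G S (forward_path G S M (Suc i))"
  note d = forward_path_min[OF M(1) im(3)]
  note e = forward_path_min[OF M(1) im(2)]
  show ?case
  proof (cases "M ! i \<subset> M ! Suc i")
    case True
    then have "?d = ?e" using M(2) im unfolding reduced_def by blast
    then show ?thesis
      using forward_path_up[OF C(1) im(4) _ _ d(1)] IH True Ci by simp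
  next
    case False
    define y where "y = max_elt G S (forward_path G S M i)"
    define z where "z = max_elt G S (forward_path G S C (a + i))"
    note dcM = forward_path_double_coset[OF M(1) im(3)]
    have dcC: "forward_path G S C (a + i) \<in> double_cosets G (C ! 0) (C ! (a + i))"
      using forward_path_double_coset[OF C(1)] im by simp
    have ni: "\<not> C ! (a + i) \<subset> C ! Suc (a + i)" using False Ci by simp
    note downM = forward_path_down[OF M(1) im(2) False dcM, folded y_def]
    note downC = forward_path_down[OF C(1) im(4) ni dcC, folded z_def]
    have y: "y \<in> forward_path G S M i" "descends_right (M ! i) y"
      unfolding y_def using max_elt_double_coset[OF S(2,3) dcM downM(3)] by auto
    have z: "z \<in> forward_path G S C (a + i)" "descends_right (M ! i) z"
      unfolding z_def using max_elt_double_coset[OF S(1,3) dcC[unfolded Ci] downC(3)] by auto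
    have sub: "dcos (M ! 0) ?d (M ! i) \<subseteq> dcos (C ! 0) ?d (M ! i)"
      by (rule dcos_subset[OF S(1,3) start(2) subset_refl d(1) dcos_self[OF d(1)]])
    have yd: "y \<in> dcos (C ! 0) ?d (M ! i)" using y(1) sub d(2) by blast
    have zd: "z \<in> dcos (C ! 0) ?d (M ! i)" using z(1) IH by blast
    obtain g where g: "g \<in> generate G (C ! 0)" "z = g \<otimes> y"
      by (rule descends_right_same_coset[OF S(1,3) d(1) asc[OF im(1)] d(4) yd y(2) zd z(2)])
    have gc: "g \<in> carrier G" using generate_closed[OF S(1) g(1)] .
    have "z \<in> dcos (C ! 0) y (M ! Suc i)"
      unfolding mem_dcos by (intro bexI[OF _ g(1)] bexI[OF _ generate.one]) (use g gc downM(2) in simp)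
    then have "dcos (C ! 0) z (M ! Suc i) = dcos (C ! 0) y (M ! Suc i)"
      by (rule dcos_eq[OF S(1,4) downM(2)])
    moreover have "dcos (M ! 0) y (M ! Suc i) \<subseteq> dcos (C ! 0) y (M ! Suc i)"
      by (rule dcos_subset[OF S(1,4) start(2) subset_refl downM(2) dcos_self[OF downM(2)]])
    then have "?e \<in> dcos (C ! 0) y (M ! Suc i)"
      using dcos_self[OF e(1)] e(2) downM(1) by blast
    then have "dcos (C ! 0) ?e (M ! Suc i) = dcos (C ! 0) y (M ! Suc i)"
      by (rule dcos_eq[OF S(1,4) downM(2)])
    ultimately show ?thesis using downC(1) Ci by simp
  qed
qed

text \<open>
  As long as \<open>C ! i\<close> stays inside \<open>J = C ! 0\<close>, all cosets of the path, and so all maxima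
  occurring on it, stay in \<open>W\<^sub>J\<close>.
\<close>

lemma forward_path_removing:
  assumes C: "is_expression G S C" "a < length C"
    and rem: "\<And>i. i < a \<Longrightarrow> C ! Suc i \<subset> C ! i" and i: "i \<le> a"
  shows "C ! i \<subseteq> C ! 0 \<and> forward_path G S C i = dcos (C ! 0) \<one> (C ! i)"
  using i
proof (induction i)
  case 0
  show ?case using forward_path_0[OF C(1)] by simp
next
  case (Suc i)
  then have IH: "C ! i \<subseteq> C ! 0" "forward_path G S C i = dcos (C ! 0) \<one> (C ! i)" by auto
  have i: "Suc i < length C" "i < length C" using Suc.prems C(2) by auto
  have S: "C ! 0 \<subseteq> S" "C ! i \<subseteq> S" "C ! Suc i \<subseteq> S"
    using expression_start[OF C(1)] expression_subset[OF C(1)] i by auto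
  have sub: "C ! Suc i \<subset> C ! i" using rem[of i] Suc.prems by simp
  then have ni: "\<not> C ! i \<subset> C ! Suc i" by blast
  define z where "z = max_elt G S (forward_path G S C i)"
  note dcC = forward_path_double_coset[OF C(1) i(2)]
  note down = forward_path_down[OF C(1) i(1) ni dcC, folded z_def]
  have "z \<in> dcos (C ! 0) \<one> (C ! i)"
    unfolding z_def using max_elt_double_coset(1)[OF S(1,2) dcC down(3)] IH(2) by simp
  then obtain g h where gh: "g \<in> generate G (C ! 0)" "h \<in> generate G (C ! i)" "z = g \<otimes> \<one> \<otimes> h"
    unfolding mem_dcos by blast
  have "h \<in> generate G (C ! 0)" using gh(2) mono_generate[OF IH(1)] by blast
  then have "g \<otimes> h \<in> generate G (C ! 0)" by (rule generate_mult[OF gh(1)])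
  moreover have "z = (g \<otimes> h) \<otimes> \<one> \<otimes> \<one>"
    using gh generate_closed[OF S(1) gh(1)] generate_closed[OF S(2) gh(2)] by simp
  ultimately have "z \<in> dcos (C ! 0) \<one> (C ! Suc i)"
    unfolding mem_dcos using generate.one by blast
  then have "dcos (C ! 0) z (C ! Suc i) = dcos (C ! 0) \<one> (C ! Suc i)"
    by (rule dcos_eq[OF S(1,3) one_closed])
  then show ?case using down(1) sub IH(1) by auto
qed

lemma forward_path_adding:
  assumes C: "is_expression G S C" "a + n < length C"
    and add: "\<And>i. i < n \<Longrightarrow> C ! (a + i) \<subset> C ! Suc (a + i)"
    and start: "forward_path G S C a = dcos (C ! 0) d (C ! a)" "d \<in> carrier G"
    and i: "i \<le> n"
  shows "forward_path G S C (a + i) = dcos (C ! 0) d (C ! (a + i))"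
  using i
proof (induction i)
  case 0
  show ?case using start by simp
next
  case (Suc i)
  then show ?case
    using forward_path_up[OF C(1) _ add[of i] _ start(2)] C(2) by simp
qed

text \<open>
  The minimal element \<open>d\<close> of \<open>p\<close> has no descents in \<open>J\<close> and \<open>I\<close>, let alone in the smaller
  redundancies, so it is minimal in its own core.
\<close>

lemma min_elt_core:
  assumes "J \<subseteq> S" "I \<subseteq> S" "p \<in> double_cosets G J I"
  shows "min_elt G S (core G S J I p) = min_elt G S p"
proof -
  let ?K = "left_redundancy G S J I p" and ?L = "right_redundancy G S J I p"
  let ?d = "min_elt G S p"
  note d = min_elt_double_coset[OF assms]
  have S: "?K \<subseteq> S" "?L \<subseteq> S" and sub: "?K \<subseteq> J" "?L \<subseteq> I"
    using assms unfolding left_redundancy_def right_redundancy_def by auto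
  define q0 where "q0 = dcos ?K ?d ?L"
  have min: "min_elt G S q0 = ?d"
    unfolding q0_def by (rule min_elt_dcos[OF S d(1)])
      (use d(4,5) sub in \<open>auto simp: ascends_left_def ascends_right_def\<close>)
  have dc: "q0 \<in> double_cosets G ?K ?L"
    unfolding double_cosets_iff q0_def using d(1) by blast
  have uniq: "q = q0" if "q \<in> double_cosets G ?K ?L \<and> min_elt G S q = ?d" for q
  proof -
    have "q = dcos ?K (min_elt G S q) ?L" using min_elt_double_coset(3)[OF S] that by blast
    also have "\<dots> = q0" using that unfolding q0_def by metis
    finally show ?thesis .
  qed
  have "core G S J I p = q0"
    unfolding core_def by (rule the_equality) (use min dc in blast, rule uniq)
  then show ?thesis using min by metis
qed

lemma core_expression_extends:
  assumes fin: "I \<subseteq> S" "J \<subseteq> S" and p: "p \<in> double_cosets G J I"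
    and K: "K = left_redundancy G S J I p" and L: "L = right_redundancy G S J I p"
    and A: "removing_expression G S J K A" and B: "adding_expression G S L I B"
    and M: "reduced_expression_for G S K L (core G S J I p) M"
  shows "reduced_expression_for G S J I p (A \<circ>\<^sub>e M \<circ>\<^sub>e B)"
proof -
  define C where "C = A \<circ>\<^sub>e M \<circ>\<^sub>e B"
  define a where "a = length A - 1"
  define m where "m = length M - 1"
  define n where "n = length B - 1"
  define d where "d = min_elt G S p"
  define e where "e i = min_elt G S (forward_path G S M i)" for i
  have A': "is_expression G S A" "A \<noteq> []" "hd A = J" "last A = K"
    "\<And>i. i < a \<Longrightarrow> A ! Suc i \<subset> A ! i"
    using A by (auto simp: removing_expression_def is_expression_def a_def)
  have B': "is_expression G S B" "B \<noteq> []" "hd B = L" "last B = I"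
    "\<And>i. i < n \<Longrightarrow> B ! i \<subset> B ! Suc i"
    using B by (auto simp: adding_expression_def is_expression_def n_def)
  have M': "is_expression G S M" "M \<noteq> []" "hd M = K" "last M = L" "reduced G S M"
    "forward_path G S M m = core G S J I p"
    using M by (auto simp: reduced_expression_for_def expression_for_def is_expression_def m_def)
  have len: "length A = Suc a" "length M = Suc m" "length B = Suc n"
    using A'(2) M'(2) B'(2) by (simp_all add: a_def m_def n_def)
  \<comment> \<open>The sets of \<open>C\<close> at positions up to \<open>a\<close>, from \<open>a\<close> to \<open>a + m\<close>, and from \<open>a + m\<close> on; consecutive
    segments share an end.\<close>
  have AM: "is_expression G S (A \<circ>\<^sub>e M)" "length (A \<circ>\<^sub>e M) = Suc (a + m)" "last (A \<circ>\<^sub>e M) = hd B"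
    "A \<circ>\<^sub>e M \<noteq> []"
    using expr_concat_is_expression[OF A'(1) M'(1)] expr_concat_length[of A M]
      expr_concat_last[of A M] A' M' B' len by (auto simp: expr_concat_def)
  have C: "is_expression G S C" "length C = Suc (a + m + n)" "last C = I"
    unfolding C_def using expr_concat_is_expression[OF AM(1) B'(1)] expr_concat_length[of "A \<circ>\<^sub>e M" B]
      expr_concat_last[of "A \<circ>\<^sub>e M" B] AM B' len by auto
  have CA: "C ! i = A ! i" if "i \<le> a" for i
    unfolding C_def using that AM(2) len by (simp add: expr_concat_nth_left)
  have CM: "C ! (a + i) = M ! i" if "i \<le> m" for i
    unfolding C_def using that AM(2) len A' M' expr_concat_nth_right[of A M i]
    by (simp add: expr_concat_nth_left)
  have CB: "C ! (a + m + i) = B ! i" if "i \<le> n" for i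
    unfolding C_def using that AM len expr_concat_nth_right[of "A \<circ>\<^sub>e M" B i] by simp
  have C0: "C ! 0 = J" using CA[of 0] A' by (simp add: hd_conv_nth)
  have M0: "M ! 0 = K" "M ! m = L" "B ! 0 = L" "B ! n = I" "A ! a = K"
    using M' B' A' len by (simp_all add: hd_conv_nth last_conv_nth)
  note dp = min_elt_double_coset[OF fin(2,1) p, folded d_def]
  have K': "K = redundancy J d I" unfolding K d_def by (rule left_redundancy_eq[OF fin(2,1) p])
  have L': "L = {r \<in> I. \<exists>s\<in>J. s \<otimes> d = d \<otimes> r}"
    unfolding L d_def by (rule right_redundancy_eq[OF fin(2,1) p])
  have KL: "redundancy J d L = K" unfolding K' L' redundancy_def by blast
  have KJ: "K \<subseteq> J" unfolding K' redundancy_def by blast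
  have em: "e m = d" unfolding e_def M'(6) d_def by (rule min_elt_core[OF fin(2,1) p])
  have inv: "ascends_left J (e i)" "redundancy J (e i) (M ! i) = K" if "i \<le> m" for i
  proof -
    have "ascends_left J (e i) \<and> redundancy J (e i) (M ! i) = M ! 0"
      unfolding e_def
      by (rule reduced_path_invariant[OF M'(1,5) fin(2) _ _ _ _ that])
        (use KJ KL dp(4) em M0 len in \<open>auto simp: e_def\<close>)
    then show "ascends_left J (e i)" "redundancy J (e i) (M ! i) = K" using M0 by auto
  qed
  have pathA: "forward_path G S C i = dcos J \<one> (C ! i)" if "i \<le> a" for i
    using forward_path_removing[OF C(1), of a i] that C(2) CA A'(5) C0 by simp
  have pathM: "forward_path G S C (a + i) = dcos J (e i) (M ! i)" if "i \<le> m" for i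
    unfolding e_def C0[symmetric]
    by (rule forward_path_suffix[OF M'(1,5) C(1), where m = m])
      (use that C(2) CM CA pathA[of a] C0 M0 KJ inv(1) len in \<open>auto simp: e_def\<close>)
  have pathB: "forward_path G S C (a + m + i) = dcos J d (B ! i)" if "i \<le> n" for i
  proof -
    have "forward_path G S C (a + m + i) = dcos (C ! 0) d (C ! (a + m + i))"
    proof (rule forward_path_adding[OF C(1), where n = n])
      fix j assume "j < n"
      then show "C ! (a + m + j) \<subset> C ! Suc (a + m + j)"
        using CB[of j] CB[of "Suc j"] B'(5)[of j] by simp
    next
      show "forward_path G S C (a + m) = dcos (C ! 0) d (C ! (a + m))"
        using pathM[of m] em C0 CM[of m] by simp
    qed (use that C(2) dp(1) in auto)
    then show ?thesis using C0 CB[OF that] by simp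
  qed
  have "forward_path G S C (a + m + n) = p" using pathB[of n] M0 dp(3) by simp
  moreover have "hd C = J" using C0 C(2) by (subst hd_conv_nth) auto
  ultimately have "expression_for G S J I p C"
    unfolding expression_for_def using C by simp
  moreover have "reduced G S C" unfolding reduced_def
  proof (intro allI impI)
    fix i assume i: "Suc i < length C" and up: "C ! i \<subset> C ! Suc i"
    \<comment> \<open>From position \<open>a\<close> on every coset has left redundancy \<open>K\<close>; it remains to compare minimal elements.\<close>
    have key: "min_elt G S (forward_path G S C j) = x \<and>
        left_redundancy G S J (C ! j) (forward_path G S C j) = K"
      if "forward_path G S C j = dcos J x (C ! j)" "j < length C" "x \<in> carrier G"
        "ascends_left J x" "ascends_right (C ! j) x" "redundancy J x (C ! j) = K" for j x
    proof -
      have "min_elt G S (forward_path G S C j) = x"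
        using min_elt_dcos[OF fin(2) expression_subset(1)[OF C(1) that(2)] that(3-5)] that(1) by simp
      moreover have "forward_path G S C j \<in> double_cosets G J (C ! j)"
        using forward_path_double_coset[OF C(1) that(2)] C0 by simp
      ultimately show ?thesis
        using left_redundancy_eq[OF fin(2) expression_subset(1)[OF C(1) that(2)]] that(6) by simp
    qed
    have keyM: "min_elt G S (forward_path G S C (a + j)) = e j \<and>
        left_redundancy G S J (C ! (a + j)) (forward_path G S C (a + j)) = K" if "j \<le> m" for j
    proof (rule key)
      have j: "j < length M" using that len by simp
      show "e j \<in> carrier G" "ascends_right (C ! (a + j)) (e j)"
        using forward_path_min[OF M'(1) j] CM[OF that] by (simp_all add: e_def)
    qed (use that pathM inv CM C(2) in simp_all)
    have BI: "B ! j \<subseteq> I" "L \<subseteq> B ! j" if "j \<le> n" for j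
    proof -
      have mono: "B ! i \<subseteq> B ! k" if "i \<le> k" "k \<le> n" for i k
        using that
      proof (induction k rule: dec_induct)
        case (step k)
        then show ?case using B'(5)[of k] by auto
      qed simp
      show "B ! j \<subseteq> I" "L \<subseteq> B ! j" using mono[of j n] mono[of 0 j] that M0 by auto
    qed
    have keyB: "min_elt G S (forward_path G S C (a + m + j)) = d \<and>
        left_redundancy G S J (C ! (a + m + j)) (forward_path G S C (a + m + j)) = K" if "j \<le> n" for j
    proof (rule key)
      show "ascends_right (C ! (a + m + j)) d"
        using dp(5) BI[OF that] CB[OF that] by (auto simp: ascends_right_def)
      have "redundancy J d L \<subseteq> redundancy J d (B ! j)" "redundancy J d (B ! j) \<subseteq> redundancy J d I"
        using BI[OF that] by (auto simp: redundancy_def)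
      then show "redundancy J d (C ! (a + m + j)) = K" using KL K' CB[OF that] by simp
    qed (use that pathB CB dp C(2) in simp_all)
    consider "i < a" | j where "i = a + j" "j < m" | j where "i = a + m + j" "j < n"
    proof -
      have "i < a \<or> (\<exists>j. i = a + j \<and> j < m) \<or> (\<exists>j. i = a + m + j \<and> j < n)"
        using i C(2) by presburger
      then show thesis using that by blast
    qed
    then show "min_elt G S (forward_path G S C i) = min_elt G S (forward_path G S C (Suc i)) \<and>
      left_redundancy G S (C ! 0) (C ! i) (forward_path G S C i) =
      left_redundancy G S (C ! 0) (C ! Suc i) (forward_path G S C (Suc i))"
    proof cases
      case 1
      then show ?thesis using up A'(5)[of i] CA[of i] CA[of "Suc i"] by auto
    next
      case (2 j)
      then have "M ! j \<subset> M ! Suc j" using up CM[of j] CM[of "Suc j"] by simp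
      then have "e j = e (Suc j)" using M'(5) 2 len unfolding reduced_def e_def by simp
      then show ?thesis using keyM[of j] keyM[of "Suc j"] 2 C0 by simp
    next
      case (3 j)
      then show ?thesis using keyB[of j] keyB[of "Suc j"] C0 by simp
    qed
  qed
  ultimately show ?thesis unfolding reduced_expression_for_def C_def by blast
qed

end

theorem proposition4p28:
  fixes G :: "('a, 'b) monoid_scheme" and S I J K L p :: "'a set"
    and A M B :: "'a set list"
  assumes "coxeter_system G S"
    and "finitary G S I" and "finitary G S J"
    and "p \<in> double_cosets G J I"
    and "K = left_redundancy G S J I p"
    and "L = right_redundancy G S J I p"
    and "removing_expression G S J K A"
    and "adding_expression G S L I B"
    and "reduced_expression_for G S K L (core G S J I p) M"
  shows "reduced_expression_for G S J I p (A \<circ>\<^sub>e M \<circ>\<^sub>e B)"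
proof -
  interpret coxeter_system G S by fact
  show ?thesis
    using core_expression_extends[OF _ _ assms(4-9)] assms(2,3) by (simp add: finitary_def)
qed

end
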